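(* The deductive system consisting of equational logic, the axioms of Kleene algebra, the equations $a\bar a=1$ for all $a\in\Sigma$ and $a\bar b=0$ for all $a,b\in\Sigma$ with $a\neq b$, and the rule $$\frac{\sum_i p_i\#q_i\#r_i\ \le\ \sum_j u_j\#v_j\#w_j}{\sum_i\bar e_{i1}e_{i2}\ \le\ \sum_j\bar d_{j1}d_{j2}}$$ (with side conditions as specified in the context) is sound and complete for the equational theory of the push-pop fragment of StacKAT: for all push-pop programs $e,d$, the equation $e=d$ is derivable if and only if $\llbracket e\rrbracket=\llbracket d\rrbracket$.
   Context: Fix a finite nonempty set $V\subseteq\mathbb N$ of values and a finite set $F$ of fields. Packets are pairs $\langle h,s\rangle$ with $h:F\to V$ and $s$ a finite list over $V$ (head = top of stack). Write $a$ for the letter $\mathsf{push}(a)$ and $\bar a$ for the letter $\mathsf{pop}(a)$, $a\in V$; let $\Sigma$ denote the set of push letters and $\bar\Sigma$ the set of pop letters. Push-pop programs are regular expressions over $\Sigma\cup\bar\Sigma$. The semantics $\llbracket e\rrbracket$ is a binary relation on packets: $0$ is $\emptyset$, $1$ the identity, $+$ union, $\cdot$ relational composition (left to right), $^*$ reflexive transitive closure, $\llbracket a\rrbracket=\{(\langle h,s\rangle,\langle h,a::s\rangle)\}$, $\llbracket\bar a\rrbracket=\{(\langle h,a::s\rangle,\langle h,s\rangle)\}$. Kleene algebra axioms: idempotent semiring axioms, $1+ee^*\le e^*$, $1+e^*e\le e^*$, and the rules $b+ax\le x\Rightarrow a^*b\le x$, $b+xa\le x\Rightarrow ba^*\le x$;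 here $e\le d$ abbreviates $e+d=d$. The letters are constants: the equations $a\bar a=1$, $a\bar b=0$ are for letters only. $L(e)$ is the usual regular language of $e$. A pure push (pure pop) expression is a regular expression using only letters from $\Sigma$ (from $\bar\Sigma$). For $x=a_1\cdots a_n\in\Sigma^*$, $\bar x=\bar a_n\cdots\bar a_1$; for a pure push expression $e$, $\bar e$ is the corresponding pure pop expression, with $L(\bar e)=\{\bar x\mid x\in L(e)\}$; every pure pop expression is, up to language equality, of this form. For $B\subseteq\Sigma^*$, $B^\dagger=\{\bar xx\mid x\in B\}$; $L(e^\dagger)=L(e)^\dagger$ for pure push $e$, extended to products and sums in the usual way, and $\Sigma^{*\dagger}=(\Sigma^* )^\dagger$. Side conditions of the rule: the sums are finite; $\bar e_{i1},\bar d_{j1}$ are pure pop and $e_{i2},d_{j2}$ pure push expressions; $p_i,q_i,r_i,u_j,v_j,w_j$ are pure push expressions; $\#$ is a fresh letter; the premise is an inequality between regular expressions over $\Sigma\cup\{\#\}$, derived by Kleene algebra; each term $\bar p_iq_i^\dagger r_i$ and $\bar u_jv_j^\dagger w_j$ has one of the four forms $$\bar d_1\bar a\,d^\dagger\,b\,d_2\ (a\ne b),\qquad \bar d_1\bar a\,d^\dagger,\qquad d^\dagger\,b\,d_2,\qquad d^\dagger$$ with $d_1,d,d_2$ pure push expressions and $a,b\in\Sigma$ (so that the corresponding term in the premise has respectively the form $ad_1\#d\#bd_2$ with $a\neq b$, $ad_1\#d\#$, $\#d\#bd_2$, $\#d\#$); and $$L\Bigl(\sum_i\bar e_{i1}\Sigma^{*\dagger}e_{i2}\Bigr)=L\Bigl(\sum_i\bar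 p_iq_i^\dagger r_i\Bigr),\qquad L\Bigl(\sum_j\bar d_{j1}\Sigma^{*\dagger}d_{j2}\Bigr)=L\Bigl(\sum_j\bar u_jv_j^\dagger w_j\Bigr).$$ *)

theory Defs
  imports Main "HOL-Library.FuncSet"
begin

datatype (atoms: 'a) rexp =
    Zero
  | One
  | Atom 'a
  | Plus "'a rexp" "'a rexp"  (infixl "\<oplus>" 65)
  | Times "'a rexp" "'a rexp"  (infixl "\<odot>" 70)
  | Star "'a rexp"

abbreviation over :: "'a set \<Rightarrow> 'a rexp \<Rightarrow> bool" where
  "over A e \<equiv> atoms e \<subseteq> A"

definition rsum :: "(nat \<Rightarrow> 'a rexp) \<Rightarrow> nat \<Rightarrow> 'a rexp" where
  "rsum f n = foldr (\<lambda>i s. f i \<oplus> s) [0..<n] Zero"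

definition conc :: "'a list set \<Rightarrow> 'a list set \<Rightarrow> 'a list set"  (infixr "@@" 75) where
  "A @@ B = {x @ y | x y. x \<in> A \<and> y \<in> B}"

primrec lang :: "'a rexp \<Rightarrow> 'a list set" where
  "lang Zero = {}"
| "lang One = {[]}"
| "lang (Atom a) = {[a]}"
| "lang (e \<oplus> d) = lang e \<union> lang d"
| "lang (e \<odot> d) = lang e @@ lang d"
| "lang (Star e) = concat ` lists (lang e)"

text \<open>
  \<open>derivable A Ax e d\<close>: the equation \<open>e = d\<close> between regular expressions over the
  alphabet \<open>A\<close> is derivable from the Kleene algebra axioms and the additional equations \<open>Ax\<close>.
  An inequality \<open>e \<le> d\<close> stands for the equation \<open>e \<oplus> d = d\<close>.  Letters are constants, so the
  equations in \<open>Ax\<close> are not closed under substitution for letters.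
\<close>

inductive derivable ::
  "'a set \<Rightarrow> ('a rexp \<Rightarrow> 'a rexp \<Rightarrow> bool) \<Rightarrow> 'a rexp \<Rightarrow> 'a rexp \<Rightarrow> bool"
  for A :: "'a set" and Ax :: "'a rexp \<Rightarrow> 'a rexp \<Rightarrow> bool"
where
  axm: "Ax e d \<Longrightarrow> derivable A Ax e d"
| eq_refl: "over A e \<Longrightarrow> derivable A Ax e e"
| eq_sym: "derivable A Ax e d \<Longrightarrow> derivable A Ax d e"
| eq_trans: "derivable A Ax e f \<Longrightarrow> derivable A Ax f d \<Longrightarrow> derivable A Ax e d"
| plus_cong: "derivable A Ax e e' \<Longrightarrow> derivable A Ax d d' \<Longrightarrow> derivable A Ax (e \<oplus> d) (e' \<oplus> d')"
| times_cong: "derivable A Ax e e' \<Longrightarrow> derivable A Ax d d' \<Longrightarrow> derivable A Ax (e \<odot> d) (e' \<odot> d')"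
| star_cong: "derivable A Ax e e' \<Longrightarrow> derivable A Ax (Star e) (Star e')"
| plus_assoc: "over A e \<Longrightarrow> over A f \<Longrightarrow> over A g \<Longrightarrow>
    derivable A Ax ((e \<oplus> f) \<oplus> g) (e \<oplus> (f \<oplus> g))"
| plus_comm: "over A e \<Longrightarrow> over A f \<Longrightarrow> derivable A Ax (e \<oplus> f) (f \<oplus> e)"
| plus_zero: "over A e \<Longrightarrow> derivable A Ax (e \<oplus> Zero) e"
| plus_idem: "over A e \<Longrightarrow> derivable A Ax (e \<oplus> e) e"
| times_assoc: "over A e \<Longrightarrow> over A f \<Longrightarrow> over A g \<Longrightarrow>
    derivable A Ax ((e \<odot> f) \<odot> g) (e \<odot> (f \<odot> g))"
| one_left: "over A e \<Longrightarrow> derivable A Ax (One \<odot> e) e"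
| one_right: "over A e \<Longrightarrow> derivable A Ax (e \<odot> One) e"
| zero_left: "over A e \<Longrightarrow> derivable A Ax (Zero \<odot> e) Zero"
| zero_right: "over A e \<Longrightarrow> derivable A Ax (e \<odot> Zero) Zero"
| distrib_left: "over A e \<Longrightarrow> over A f \<Longrightarrow> over A g \<Longrightarrow>
    derivable A Ax (e \<odot> (f \<oplus> g)) (e \<odot> f \<oplus> e \<odot> g)"
| distrib_right: "over A e \<Longrightarrow> over A f \<Longrightarrow> over A g \<Longrightarrow>
    derivable A Ax ((e \<oplus> f) \<odot> g) (e \<odot> g \<oplus> f \<odot> g)"
| star_unfold_left: "over A e \<Longrightarrow> derivable A Ax ((One \<oplus> e \<odot> Star e) \<oplus> Star e) (Star e)"
| star_unfold_right: "over A e \<Longrightarrow> derivable A Ax ((One \<oplus> Star e \<odot> e) \<oplus> Star e) (Star e)"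
| star_induct_left: "derivable A Ax ((b \<oplus> a \<odot> x) \<oplus> x) x \<Longrightarrow>
    derivable A Ax ((Star a \<odot> b) \<oplus> x) x"
| star_induct_right: "derivable A Ax ((b \<oplus> x \<odot> a) \<oplus> x) x \<Longrightarrow>
    derivable A Ax ((b \<odot> Star a) \<oplus> x) x"

abbreviation KA_le :: "'a set \<Rightarrow> 'a rexp \<Rightarrow> 'a rexp \<Rightarrow> bool" where
  "KA_le A e d \<equiv> derivable A (\<lambda>_ _. False) (e \<oplus> d) d"

text \<open>\<open>Hash\<close> is the fresh letter \<open>#\<close>; it does not occur in programs.\<close>

datatype letter = Push nat | Pop nat | Hash

definition push_letters :: "nat set \<Rightarrow> letter set" where
  "push_letters V = Push ` V"

definition pop_letters :: "nat set \<Rightarrow> letter set" where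
  "pop_letters V = Pop ` V"

abbreviation program :: "nat set \<Rightarrow> letter rexp \<Rightarrow> bool" where
  "program V e \<equiv> over (push_letters V \<union> pop_letters V) e"

abbreviation pure_push :: "nat set \<Rightarrow> letter rexp \<Rightarrow> bool" where
  "pure_push V e \<equiv> over (push_letters V) e"

abbreviation pure_pop :: "nat set \<Rightarrow> letter rexp \<Rightarrow> bool" where
  "pure_pop V e \<equiv> over (pop_letters V) e"

type_synonym 'f packet = "('f \<Rightarrow> nat) \<times> nat list"

definition packets :: "nat set \<Rightarrow> 'f set \<Rightarrow> 'f packet set" where
  "packets V F = (F \<rightarrow>\<^sub>E V) \<times> lists V"

primrec sem_letter :: "nat set \<Rightarrow> 'f set \<Rightarrow> letter \<Rightarrow> 'f packet rel" where
  "sem_letter V F (Push a) = {((h, s), (h, a # s)) | h s. (h, a # s) \<in> packets V F}"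
| "sem_letter V F (Pop a) = {((h, a # s), (h, s)) | h s. (h, a # s) \<in> packets V F}"
| "sem_letter V F Hash = {}"

text \<open>
  The intersection in the last clause makes the closure reflexive on \<open>packets V F\<close> only,
  rather than on the whole type.
\<close>

primrec sem :: "nat set \<Rightarrow> 'f set \<Rightarrow> letter rexp \<Rightarrow> 'f packet rel" where
  "sem V F Zero = {}"
| "sem V F One = Id_on (packets V F)"
| "sem V F (Atom l) = sem_letter V F l"
| "sem V F (e \<oplus> d) = sem V F e \<union> sem V F d"
| "sem V F (e \<odot> d) = sem V F e O sem V F d"
| "sem V F (Star e) = (sem V F e)\<^sup>* \<inter> packets V F \<times> packets V F"

text \<open>Only the values of the bar functions on pure push words and expressions matter.\<close>

primrec bar_letter :: "letter \<Rightarrow> letter" where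
  "bar_letter (Push a) = Pop a"
| "bar_letter (Pop a) = Push a"
| "bar_letter Hash = Hash"

definition bar_word :: "letter list \<Rightarrow> letter list" where
  "bar_word x = rev (map bar_letter x)"

primrec bar :: "letter rexp \<Rightarrow> letter rexp" where
  "bar Zero = Zero"
| "bar One = One"
| "bar (Atom l) = Atom (bar_letter l)"
| "bar (e \<oplus> d) = bar e \<oplus> bar d"
| "bar (e \<odot> d) = bar d \<odot> bar e"
| "bar (Star e) = Star (bar e)"

definition dagger :: "letter list set \<Rightarrow> letter list set" where
  "dagger B = {bar_word x @ x | x. x \<in> B}"

lemma bar_word_concat: "bar_word (concat ws) = concat (rev (map bar_word ws))"
  by (induction ws) (simp_all add: bar_word_def)

lemma lang_bar: "lang (bar e) = bar_word ` lang e"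
proof (induction e)
  case (Times e d)
  have *: "bar_word (x @ y) = bar_word y @ bar_word x" for x y
    by (simp add: bar_word_def)
  show ?case
    unfolding bar.simps lang.simps Times conc_def by (auto simp: image_iff) (metis *)+
next
  case (Star e)
  have "concat ` lists (bar_word ` lang e) = bar_word ` concat ` lists (lang e)" (is "?l = ?r")
  proof (intro equalityI subsetI)
    fix w assume "w \<in> ?l"
    then obtain ws where ws: "ws \<in> lists (lang e)" "w = concat (map bar_word ws)"
      by (auto simp: lists_image)
    then have "w = bar_word (concat (rev ws))" by (simp add: bar_word_concat rev_map)
    moreover have "rev ws \<in> lists (lang e)" using ws by auto
    ultimately show "w \<in> ?r" by blast
  next
    fix w assume "w \<in> ?r"
    then obtain ws where ws: "ws \<in> lists (lang e)" "w = bar_word (concat ws)" by auto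
    then have "w = concat (map bar_word (rev ws))" by (simp add: bar_word_concat rev_map)
    moreover have "map bar_word (rev ws) \<in> lists (bar_word ` lang e)" using ws by auto
    ultimately show "w \<in> ?l" by blast
  qed
  then show ?case by (simp add: Star)
qed (auto simp: bar_word_def)

lemma bar_surj: "pure_pop V f \<Longrightarrow> \<exists>e. pure_push V e \<and> f = bar e"
proof (induction f)
  case Zero
  show ?case by (rule exI[of _ Zero]) simp
next
  case One
  show ?case by (rule exI[of _ One]) simp
next
  case (Atom l)
  then obtain a where "a \<in> V" "l = Pop a" by (auto simp: pop_letters_def)
  then show ?case by (intro exI[of _ "Atom (Push a)"]) (simp add: push_letters_def)
next
  case (Plus f g)
  then obtain e d where "pure_push V e" "f = bar e" "pure_push V d" "g = bar d" by auto
  then show ?case by (intro exI[of _ "e \<oplus> d"]) simp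
next
  case (Times f g)
  then obtain e d where "pure_push V e" "f = bar e" "pure_push V d" "g = bar d" by auto
  then show ?case by (intro exI[of _ "d \<odot> e"]) simp
next
  case (Star f)
  then obtain e where "pure_push V e" "f = bar e" by auto
  then show ?case by (intro exI[of _ "Star e"]) simp
qed

text \<open>
  \<open>dagger_form V p q r\<close>: the term \<open>bar p \<cdot> q\<^sup>\<dagger> \<cdot> r\<close> has one of the four admissible forms.  Note
  that \<open>bar (Atom (Push a) \<odot> d1) = bar d1 \<odot> Atom (Pop a)\<close>; an absent factor is \<open>One\<close>.
\<close>

inductive dagger_form :: "nat set \<Rightarrow> letter rexp \<Rightarrow> letter rexp \<Rightarrow> letter rexp \<Rightarrow> bool"
  for V :: "nat set"
where
  both: "a \<in> V \<Longrightarrow> b \<in> V \<Longrightarrow> a \<noteq> b \<Longrightarrow> pure_push V d1 \<Longrightarrow> pure_push V d \<Longrightarrow> pure_push V d2 \<Longrightarrow>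
    dagger_form V (Atom (Push a) \<odot> d1) d (Atom (Push b) \<odot> d2)"
| left: "a \<in> V \<Longrightarrow> pure_push V d1 \<Longrightarrow> pure_push V d \<Longrightarrow>
    dagger_form V (Atom (Push a) \<odot> d1) d One"
| right: "b \<in> V \<Longrightarrow> pure_push V d \<Longrightarrow> pure_push V d2 \<Longrightarrow>
    dagger_form V One d (Atom (Push b) \<odot> d2)"
| none: "pure_push V d \<Longrightarrow> dagger_form V One d One"

definition hash_term :: "letter rexp \<Rightarrow> letter rexp \<Rightarrow> letter rexp \<Rightarrow> letter rexp" where
  "hash_term p q r = p \<odot> Atom Hash \<odot> q \<odot> Atom Hash \<odot> r"

text \<open>
  One side of the rule: the side conditions relating
  \<open>\<Sum>i<n. bar (e1 i) \<cdot> e2 i\<close> to \<open>\<Sum>i<n. p i \<cdot> # \<cdot> q i \<cdot> # \<cdot> r i\<close>.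
\<close>

definition side_condition ::
  "nat set \<Rightarrow> nat \<Rightarrow> (nat \<Rightarrow> letter rexp) \<Rightarrow> (nat \<Rightarrow> letter rexp) \<Rightarrow>
    (nat \<Rightarrow> letter rexp) \<Rightarrow> (nat \<Rightarrow> letter rexp) \<Rightarrow> (nat \<Rightarrow> letter rexp) \<Rightarrow> bool" where
  "side_condition V n e1 e2 p q r \<longleftrightarrow>
     (\<forall>i<n. pure_push V (e1 i) \<and> pure_push V (e2 i)) \<and>
     (\<forall>i<n. pure_push V (p i) \<and> pure_push V (q i) \<and> pure_push V (r i)) \<and>
     (\<forall>i<n. dagger_form V (p i) (q i) (r i)) \<and>
     (\<Union>i<n. lang (bar (e1 i)) @@ dagger (lists (push_letters V)) @@ lang (e2 i)) =
     (\<Union>i<n. lang (bar (p i)) @@ dagger (lang (q i)) @@ lang (r i))"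

text \<open>
  The premise of the rule is derived in Kleene algebra alone, so each conclusion of
  the rule can be treated as an axiom of the system.
\<close>

inductive stack_axiom :: "nat set \<Rightarrow> letter rexp \<Rightarrow> letter rexp \<Rightarrow> bool"
  for V :: "nat set"
where
  push_pop_same: "a \<in> V \<Longrightarrow> stack_axiom V (Atom (Push a) \<odot> Atom (Pop a)) One"
| push_pop_diff: "a \<in> V \<Longrightarrow> b \<in> V \<Longrightarrow> a \<noteq> b \<Longrightarrow>
    stack_axiom V (Atom (Push a) \<odot> Atom (Pop b)) Zero"
| hash_rule: "side_condition V m e1 e2 p q r \<Longrightarrow> side_condition V n d1 d2 u v w \<Longrightarrow>
    KA_le (push_letters V \<union> {Hash})
      (rsum (\<lambda>i. hash_term (p i) (q i) (r i)) m)
      (rsum (\<lambda>j. hash_term (u j) (v j) (w j)) n) \<Longrightarrow>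
    stack_axiom V
      (rsum (\<lambda>i. bar (e1 i) \<odot> e2 i) m \<oplus> rsum (\<lambda>j. bar (d1 j) \<odot> d2 j) n)
      (rsum (\<lambda>j. bar (d1 j) \<odot> d2 j) n)"

definition stack_derivable :: "nat set \<Rightarrow> letter rexp \<Rightarrow> letter rexp \<Rightarrow> bool" where
  "stack_derivable V = derivable (push_letters V \<union> pop_letters V) (stack_axiom V)"

end

theory Submission imports Defs begin

text \<open>
  Soundness: the relation of a program is determined by its language, and a word
  \<open>bar x \<cdot> y\<close> relates the stacks with contents \<open>z x\<close> and \<open>z y\<close> (bottom first), so both sides of
  the side conditions describe the same set of pairs \<open>(z x, z y)\<close>.

  Completeness: saturating an automaton for a program under \<open>push a \<cdot> pop a = 1\<close> shows that all
  pops can be moved in front of all pushes, which gives a normal form \<open>\<Sum>i. bar (e1 i) \<cdot> e2 i\<close>.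
  A pair of stacks has a unique maximal common bottom part.  Splitting pairs there, and
  recording the class of the common part in a finite monoid, which determines the possible
  remainders, turns every normal form into hash terms, and such terms have the same language iff the programs
  have the same relation.  The premise of the rule then follows from the completeness of
  Kleene algebra for regular languages.  For the latter, let \<open>\<rho>\<close> map words to the transition
  relations of an automaton for \<open>d\<close>, and let \<open>x m\<close> be the expression for \<open>{w. \<rho> w = m}\<close> obtained
  from the Cayley graph.  Induction on \<open>e\<close> gives \<open>e \<le> \<Sum>m\<in>\<rho> (lang e). x m\<close>, and \<open>x m \<le> d\<close>
  whenever \<open>m\<close> is accepting.
\<close>

section \<open>Derivations and languages\<close>

text \<open>Derivations below are carried out over all letters, which spares the \<open>over\<close>
  side conditions. Erasing the foreign letters afterwards brings such a derivation back to the
  alphabet \<open>A\<close>.\<close>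

fun kill :: "'a set \<Rightarrow> 'a rexp \<Rightarrow> 'a rexp" where
  "kill A (Atom a) = (if a \<in> A then Atom a else Zero)"
| "kill A (e \<oplus> d) = kill A e \<oplus> kill A d"
| "kill A (e \<odot> d) = kill A e \<odot> kill A d"
| "kill A (Star e) = Star (kill A e)"
| "kill A e = e"

lemma over_kill: "over A (kill A e)"
  by (induction e) auto

lemma kill_id: "over A e \<Longrightarrow> kill A e = e"
  by (induction e) auto

text \<open>\<open>kill A\<close> acts as a substitution, so it sends instances of the Kleene
  algebra axioms and rules to instances of the same ones. The extra axioms only contain letters of
  \<open>A\<close> and are fixed by it.\<close>

lemma derivable_UNIV_kill:
  assumes "derivable UNIV Ax e d" and "\<And>e d. Ax e d \<Longrightarrow> over A e \<and> over A d"
  shows "derivable A Ax (kill A e) (kill A d)"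
  using assms(1)
proof (induction rule: derivable.induct)
  case (axm e d)
  then show ?case using assms(2) by (simp add: kill_id derivable.axm)
next
  case (eq_trans e f d)
  then show ?case by (blast intro: derivable.eq_trans)
qed (simp_all add: derivable.intros(2,5-) derivable.eq_sym over_kill)

lemma derivable_restrict:
  assumes "derivable UNIV Ax e d" and "\<And>e d. Ax e d \<Longrightarrow> over A e \<and> over A d"
    and "over A e" and "over A d"
  shows "derivable A Ax e d"
  using derivable_UNIV_kill[OF assms(1,2)] assms(3,4) by (simp add: kill_id)

section \<open>Languages as a model of Kleene algebra\<close>

lemma lang_append: "u \<in> lang e \<Longrightarrow> v \<in> lang d \<Longrightarrow> u @ v \<in> lang (e \<odot> d)"
  by (auto simp: conc_def)

lemma conc_assoc: "(A @@ B) @@ C = A @@ B @@ C"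
proof (intro equalityI subsetI)
  fix w assume "w \<in> (A @@ B) @@ C"
  then obtain x y z where "w = (x @ y) @ z" "x \<in> A" "y \<in> B" "z \<in> C"
    unfolding conc_def by blast
  then show "w \<in> A @@ B @@ C" unfolding conc_def by auto
next
  fix w assume "w \<in> A @@ B @@ C"
  then obtain x y z where "w = x @ y @ z" "x \<in> A" "y \<in> B" "z \<in> C"
    unfolding conc_def by blast
  then have "w = (x @ y) @ z" "x @ y \<in> A @@ B" "z \<in> C" unfolding conc_def by auto
  then show "w \<in> (A @@ B) @@ C" unfolding conc_def[of "A @@ B"] by blast
qed

lemma conc_subsetI: "(\<And>u v. u \<in> A \<Longrightarrow> v \<in> B \<Longrightarrow> u @ v \<in> C) \<Longrightarrow> A @@ B \<subseteq> C"
  by (auto simp: conc_def)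

lemma conc_subsetD: "A @@ B \<subseteq> C \<Longrightarrow> u \<in> A \<Longrightarrow> v \<in> B \<Longrightarrow> u @ v \<in> C"
  by (auto simp: conc_def)

lemma Nil_in_star: "[] \<in> lang (Star e)"
  by (auto intro: image_eqI[of _ concat "[]"])

lemma star_Cons: "u \<in> lang e \<Longrightarrow> v \<in> lang (Star e) \<Longrightarrow> u @ v \<in> lang (Star e)"
  by (auto intro!: image_eqI[of _ concat "u # _"])

lemma star_snoc:
  assumes "u \<in> lang (Star e)" and "v \<in> lang e"
  shows "u @ v \<in> lang (Star e)"
proof -
  from assms obtain us where "us \<in> lists (lang e)" "u = concat us" by auto
  with assms show ?thesis by (auto intro!: image_eqI[of _ concat "us @ [v]"])
qed

lemma derivable_lang:
  assumes "derivable A (\<lambda>_ _. False) e d"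
  shows "lang e = lang d"
  using assms
proof (induction rule: derivable.induct)
  case (times_assoc e f g)
  show ?case by (simp add: conc_assoc)
next
  case (star_unfold_left e)
  have "lang (One \<oplus> e \<odot> Star e) \<subseteq> lang (Star e)"
    using Nil_in_star[of e] star_Cons[of _ e] by (simp add: conc_subsetI del: lang.simps(6))
  then show ?case by (simp only: lang.simps(4)) blast
next
  case (star_unfold_right e)
  have "lang (One \<oplus> Star e \<odot> e) \<subseteq> lang (Star e)"
    using Nil_in_star[of e] star_snoc[of _ e] by (simp add: conc_subsetI del: lang.simps(6))
  then show ?case by (simp only: lang.simps(4)) blast
next
  case (star_induct_left b a x)
  then have bx: "lang b \<subseteq> lang x" and ax: "lang a @@ lang x \<subseteq> lang x"
    by (simp_all only: lang.simps(4,5)) blast+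
  have "concat us @ v \<in> lang x" if "us \<in> lists (lang a)" "v \<in> lang b" for us v
    using that by (induction us) (use bx ax in \<open>auto dest: conc_subsetD\<close>)
  then have "lang (Star a \<odot> b) \<subseteq> lang x" by (simp, intro conc_subsetI) auto
  then show ?case by (simp only: lang.simps(4)) blast
next
  case (star_induct_right b x a)
  then have bx: "lang b \<subseteq> lang x" and xa: "lang x @@ lang a \<subseteq> lang x"
    by (simp_all only: lang.simps(4,5)) blast+
  have "v @ concat us \<in> lang x" if "us \<in> lists (lang a)" "v \<in> lang b" for us v
    using that(1)
  \<comment> \<open>\<open>x\<close> absorbs factors of \<open>a\<close> on its right, so the last
    factor is split off rather than the first.\<close>
  proof (induction us rule: rev_induct)
    case Nil
    then show ?case using that(2) bx by auto
  next
    case (snoc u us)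
    then show ?case using conc_subsetD[OF xa, of "v @ concat us" u] by simp
  qed
  then have "lang (b \<odot> Star a) \<subseteq> lang x" by (simp, intro conc_subsetI) auto
  then show ?case by (simp only: lang.simps(4)) blast
next
  case (distrib_left e f g)
  show ?case by (simp, unfold conc_def) blast
next
  case (distrib_right e f g)
  show ?case by (simp, unfold conc_def) blast
next
  case (star_cong e d)
  then show ?case by simp
next
  case (plus_assoc e f g)
  show ?case by auto
next
  case (plus_comm e f)
  show ?case by auto
qed (simp_all add: conc_def)

section \<open>The order of a Kleene algebra with extra axioms\<close>

text \<open>Sums of expressions are syntax and depend on the order of the summands, hence a list; up
  to provable equality only the set of summands matters.\<close>

definition lsum :: "'a rexp list \<Rightarrow> 'a rexp" where
  "lsum es = foldr (\<oplus>) es Zero"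

text \<open>Used mainly without extra axioms, which is pure Kleene algebra, and with
  \<open>stack_axiom V\<close>. The alphabet is \<open>UNIV\<close> throughout.\<close>

locale derivation =
  fixes Ax :: "'a rexp \<Rightarrow> 'a rexp \<Rightarrow> bool"
begin

definition le :: "'a rexp \<Rightarrow> 'a rexp \<Rightarrow> bool"  (infix "\<lesssim>" 50) where
  "e \<lesssim> d \<longleftrightarrow> derivable UNIV Ax (e \<oplus> d) d"

abbreviation eq :: "'a rexp \<Rightarrow> 'a rexp \<Rightarrow> bool"  (infix "\<approx>" 50) where
  "e \<approx> d \<equiv> derivable UNIV Ax e d"

lemma eq_rfl[simp]: "e \<approx> e"
  by (simp add: eq_refl)

lemma eq_trans'[trans]: "e \<approx> f \<Longrightarrow> f \<approx> g \<Longrightarrow> e \<approx> g"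
  by (rule eq_trans)

lemma rle_refl[simp]: "e \<lesssim> e"
  by (simp add: le_def plus_idem)

lemma eq_le:
  assumes "e \<approx> d"
  shows "e \<lesssim> d"
proof -
  have "e \<oplus> d \<approx> d \<oplus> d" by (rule plus_cong[OF assms eq_rfl])
  also have "d \<oplus> d \<approx> d" by (simp add: plus_idem)
  finally show ?thesis by (simp add: le_def)
qed

lemma eq_ge: "e \<approx> d \<Longrightarrow> d \<lesssim> e"
  by (rule eq_le[OF eq_sym])

lemma rle_antisym:
  assumes "e \<lesssim> d" and "d \<lesssim> e"
  shows "e \<approx> d"
proof -
  have "e \<approx> d \<oplus> e" using assms(2) by (simp add: le_def eq_sym)
  also have "d \<oplus> e \<approx> e \<oplus> d" by (simp add: plus_comm)
  also have "e \<oplus> d \<approx> d" using assms(1) by (simp add: le_def)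
  finally show ?thesis .
qed

lemma rle_trans[trans]:
  assumes "e \<lesssim> f" and "f \<lesssim> g"
  shows "e \<lesssim> g"
proof -
  have "e \<oplus> g \<approx> e \<oplus> (f \<oplus> g)"
    using assms(2) by (intro plus_cong eq_rfl) (simp add: le_def eq_sym)
  also have "e \<oplus> (f \<oplus> g) \<approx> (e \<oplus> f) \<oplus> g" by (rule eq_sym) (simp add: plus_assoc)
  also have "(e \<oplus> f) \<oplus> g \<approx> f \<oplus> g"
    using assms(1) by (intro plus_cong eq_rfl) (simp add: le_def)
  also have "f \<oplus> g \<approx> g" using assms(2) by (simp add: le_def)
  finally show ?thesis by (simp add: le_def)
qed

lemma le_plus1: "e \<lesssim> e \<oplus> d"
proof -
  have "e \<oplus> (e \<oplus> d) \<approx> (e \<oplus> e) \<oplus> d" by (rule eq_sym) (simp add: plus_assoc)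
  also have "(e \<oplus> e) \<oplus> d \<approx> e \<oplus> d" by (intro plus_cong eq_rfl) (simp add: plus_idem)
  finally show ?thesis by (simp add: le_def)
qed

lemma le_plus2: "d \<lesssim> e \<oplus> d"
  by (rule rle_trans[OF le_plus1 eq_le[OF plus_comm]]) simp_all

lemma plus_le_iff[simp]: "e \<oplus> d \<lesssim> f \<longleftrightarrow> e \<lesssim> f \<and> d \<lesssim> f"
proof (intro iffI conjI)
  assume "e \<lesssim> f \<and> d \<lesssim> f"
  then have *: "e \<oplus> f \<approx> f" "d \<oplus> f \<approx> f" by (simp_all add: le_def)
  have "e \<oplus> d \<oplus> f \<approx> e \<oplus> (d \<oplus> f)" by (simp add: plus_assoc)
  also have "e \<oplus> (d \<oplus> f) \<approx> e \<oplus> f" by (rule plus_cong[OF eq_rfl *(2)])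
  also have "e \<oplus> f \<approx> f" by (rule *)
  finally show "e \<oplus> d \<lesssim> f" by (simp add: le_def)
qed (use rle_trans[OF le_plus1] rle_trans[OF le_plus2] in blast)+

lemma le_plusI: "e \<lesssim> f \<or> e \<lesssim> g \<Longrightarrow> e \<lesssim> f \<oplus> g"
  using rle_trans[OF _ le_plus1] rle_trans[OF _ le_plus2] by blast

lemma zero_le[simp]: "Zero \<lesssim> e"
  by (rule rle_trans[OF le_plus2 eq_le[OF plus_zero]]) simp

lemma times_mono:
  assumes "e \<lesssim> e'" and "d \<lesssim> d'"
  shows "e \<odot> d \<lesssim> e' \<odot> d'"
proof -
  have "e \<odot> d \<oplus> e' \<odot> d \<approx> (e \<oplus> e') \<odot> d" by (rule eq_sym) (simp add: distrib_right)
  also have "(e \<oplus> e') \<odot> d \<approx> e' \<odot> d"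
    using assms(1) by (intro times_cong eq_rfl) (simp add: le_def)
  finally have 1: "e \<odot> d \<lesssim> e' \<odot> d" by (simp add: le_def)
  have "e' \<odot> d \<oplus> e' \<odot> d' \<approx> e' \<odot> (d \<oplus> d')" by (rule eq_sym) (simp add: distrib_left)
  also have "e' \<odot> (d \<oplus> d') \<approx> e' \<odot> d'"
    using assms(2) by (intro times_cong eq_rfl) (simp add: le_def)
  finally have "e' \<odot> d \<lesssim> e' \<odot> d'" by (simp add: le_def)
  with 1 show ?thesis by (rule rle_trans)
qed

lemma eq_le_cong: "e \<approx> e' \<Longrightarrow> e \<lesssim> f \<longleftrightarrow> e' \<lesssim> f"
  using rle_trans[of e e' f] rle_trans[of e' e f] eq_le[of e e'] eq_ge[of e e'] by blast

lemma eq_ge_cong: "e \<approx> e' \<Longrightarrow> f \<lesssim> e \<longleftrightarrow> f \<lesssim> e'"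
  using rle_trans[of f e e'] rle_trans[of f e' e] eq_le[of e e'] eq_ge[of e e'] by blast

text \<open>Read as rewrite rules, these bring products into right-associated form.\<close>

lemma times_assoc_le[simp]:
  "(e \<odot> f) \<odot> g \<lesssim> x \<longleftrightarrow> e \<odot> (f \<odot> g) \<lesssim> x"
  "x \<lesssim> (e \<odot> f) \<odot> g \<longleftrightarrow> x \<lesssim> e \<odot> (f \<odot> g)"
  "e \<odot> ((f \<odot> g) \<odot> h) \<lesssim> x \<longleftrightarrow> e \<odot> (f \<odot> (g \<odot> h)) \<lesssim> x"
  "e \<odot> (e' \<odot> ((f \<odot> g) \<odot> h)) \<lesssim> x \<longleftrightarrow> e \<odot> (e' \<odot> (f \<odot> (g \<odot> h))) \<lesssim> x"
  by (rule eq_le_cong eq_ge_cong; simp add: times_assoc times_cong)+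

lemma one_le[simp]:
  "One \<odot> e \<lesssim> x \<longleftrightarrow> e \<lesssim> x"
  "e \<odot> One \<lesssim> x \<longleftrightarrow> e \<lesssim> x"
  "x \<lesssim> One \<odot> e \<longleftrightarrow> x \<lesssim> e"
  "x \<lesssim> e \<odot> One \<longleftrightarrow> x \<lesssim> e"
  by (rule eq_le_cong eq_ge_cong; simp add: one_left one_right)+

lemma zero_times_le[simp]: "Zero \<odot> e \<lesssim> x" "e \<odot> Zero \<lesssim> x"
  by (subst eq_le_cong[where e' = Zero]; simp add: zero_left zero_right)+

lemma distrib_le[simp]:
  "(e \<oplus> f) \<odot> g \<lesssim> x \<longleftrightarrow> e \<odot> g \<lesssim> x \<and> f \<odot> g \<lesssim> x"
  "e \<odot> (f \<oplus> g) \<lesssim> x \<longleftrightarrow> e \<odot> f \<lesssim> x \<and> e \<odot> g \<lesssim> x"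
  by (simp_all only: plus_le_iff[symmetric], (rule eq_le_cong; simp add: distrib_left distrib_right)+)

lemma star_left: "One \<lesssim> Star e" "e \<odot> Star e \<lesssim> Star e"
  using star_unfold_left[where A = UNIV and Ax = Ax, of e]
  by (simp_all add: le_def[symmetric])

lemma star_right: "Star e \<odot> e \<lesssim> Star e"
  using star_unfold_right[where A = UNIV and Ax = Ax, of e]
  by (simp_all add: le_def[symmetric])

lemma star_left_induct: "a \<odot> x \<lesssim> x \<Longrightarrow> b \<lesssim> x \<Longrightarrow> Star a \<odot> b \<lesssim> x"
  using star_induct_left[where A = UNIV and Ax = Ax, of b a x] by (simp add: le_def[symmetric])

lemma star_right_induct: "x \<odot> a \<lesssim> x \<Longrightarrow> b \<lesssim> x \<Longrightarrow> b \<odot> Star a \<lesssim> x"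
  using star_induct_right[where A = UNIV and Ax = Ax, of b x a] by (simp add: le_def[symmetric])

lemma mult_le1: "e \<lesssim> e' \<Longrightarrow> e' \<odot> d \<lesssim> x \<Longrightarrow> e \<odot> d \<lesssim> x"
  by (rule rle_trans[OF times_mono[OF _ rle_refl]])

lemma mult_le2: "d \<lesssim> d' \<Longrightarrow> e \<odot> d' \<lesssim> x \<Longrightarrow> e \<odot> d \<lesssim> x"
  by (rule rle_trans[OF times_mono[OF rle_refl]])

lemma le_times1: "One \<lesssim> e \<Longrightarrow> x \<lesssim> d \<Longrightarrow> x \<lesssim> e \<odot> d"
  using times_mono[of One e x d] by simp

lemma le_times2: "x \<lesssim> e \<Longrightarrow> One \<lesssim> d \<Longrightarrow> x \<lesssim> e \<odot> d"
  using times_mono[of x e One d] by simp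

lemma lsum_le_iff: "lsum es \<lesssim> x \<longleftrightarrow> (\<forall>e\<in>set es. e \<lesssim> x)"
  by (induction es) (auto simp: lsum_def)

lemma le_lsum: "e \<in> set es \<Longrightarrow> e \<lesssim> lsum es"
  using lsum_le_iff[of es "lsum es"] by simp

lemma lsum_times_le_iff: "lsum es \<odot> d \<lesssim> x \<longleftrightarrow> (\<forall>e\<in>set es. e \<odot> d \<lesssim> x)"
  by (induction es) (auto simp: lsum_def)

lemma times_lsum_le_iff: "d \<odot> lsum es \<lesssim> x \<longleftrightarrow> (\<forall>e\<in>set es. d \<odot> e \<lesssim> x)"
  by (induction es) (auto simp: lsum_def)

end

section \<open>Closures of finite labelled graphs\<close>

text \<open>Entry \<open>(i, j)\<close> of the star of the matrix with edges \<open>E\<close>, by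
  recursion on edges instead of states: a walk either avoids the new edge from \<open>k\<close> to
  \<open>l\<close> or is cut at each use of it, all uses but the last forming loops at
  \<open>k\<close>.\<close>

fun gstar :: "('i \<times> 'a rexp \<times> 'i) list \<Rightarrow> 'i \<Rightarrow> 'i \<Rightarrow> 'a rexp" where
  "gstar [] i j = (if i = j then One else Zero)"
| "gstar ((k, m, l) # E) i j =
     gstar E i j \<oplus> gstar E i k \<odot> Star (m \<odot> gstar E l k) \<odot> (m \<odot> gstar E l j)"

lemma atoms_gstar: "atoms (gstar E i j) \<subseteq> (\<Union>(i, m, j)\<in>set E. atoms m)"
proof (induction E arbitrary: i j)
  case Nil
  then show ?case by simp
next
  case (Cons t E)
  obtain k m l where t: "t = (k, m, l)" by (cases t)
  show ?case unfolding t using Cons[of i j] Cons[of i k] Cons[of l k] Cons[of l j] by simp blast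
qed

text \<open>An induction principle for the words of a closure. The starred factor consists of loops
  at \<open>k\<close>, so an inner induction over these loops reduces it to single edges.\<close>

lemma gstar_lang_subset:
  assumes "w \<in> lang (gstar E i j)"
    and "\<And>i. P i [] i"
    and "\<And>i u j v k. P i u j \<Longrightarrow> P j v k \<Longrightarrow> P i (u @ v) k"
    and "\<And>i m j w. (i, m, j) \<in> set E \<Longrightarrow> w \<in> lang m \<Longrightarrow> P i w j"
  shows "P i w j"
  using assms(1,4)
proof (induction E arbitrary: i j w)
  case Nil
  then show ?case using assms(2) by (simp split: if_splits)
next
  case (Cons t E)
  obtain k m l where t: "t = (k, m, l)" by (cases t)
  have IH: "P i w j" if "w \<in> lang (gstar E i j)" for i w j
    by (rule Cons.IH[OF that]) (rule Cons.prems(2), simp_all)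
  have m: "P k w l" if "w \<in> lang m" for w by (rule Cons.prems(2)[OF _ that]) (simp add: t)
  from Cons.prems(1)[unfolded t] have "w \<in> lang (gstar E i j) \<or>
      w \<in> (lang (gstar E i k) @@ concat ` lists (lang (m \<odot> gstar E l k))) @@ lang (m \<odot> gstar E l j)"
    by simp
  then consider "w \<in> lang (gstar E i j)"
    | u vs v where "u \<in> lang (gstar E i k)" "vs \<in> lists (lang (m \<odot> gstar E l k))"
      "v \<in> lang (m \<odot> gstar E l j)" "w = (u @ concat vs) @ v"
    unfolding conc_def by blast
  then show ?case
  proof cases
    case 1
    then show ?thesis by (rule IH)
  next
    case 2
    have "P k (concat vs) k"
      using 2(2)
    proof (induction vs)
      case Nil
      then show ?case using assms(2) by simp
    next
      case (Cons w ws)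
      then obtain a b where "w = a @ b" "a \<in> lang m" "b \<in> lang (gstar E l k)"
        by (auto simp: conc_def)
      then have "P k w k" using m IH assms(3) by blast
      then show ?case using Cons assms(3) by simp
    qed
    moreover have "P k v j" using 2(3) assms(3)[OF m IH] by (auto simp: conc_def)
    moreover have "P i u k" using 2(1) by (rule IH)
    ultimately show ?thesis unfolding 2(4) using assms(3) by blast
  qed
qed

section \<open>Paths and the words they read\<close>

inductive path :: "('i \<times> 'a rexp \<times> 'i) list \<Rightarrow> 'i \<Rightarrow> 'a list \<Rightarrow> 'i \<Rightarrow> bool"
  for E :: "('i \<times> 'a rexp \<times> 'i) list" where
  path_Nil: "path E i [] i"
| path_One: "(i, One, j) \<in> set E \<Longrightarrow> path E j w k \<Longrightarrow> path E i w k"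
| path_Atom: "(i, Atom a, j) \<in> set E \<Longrightarrow> path E j w k \<Longrightarrow> path E i (a # w) k"

lemma path_append: "path E i u j \<Longrightarrow> path E j v k \<Longrightarrow> path E i (u @ v) k"
  by (induction rule: path.induct) (auto intro: path.intros)

lemma path_appendD: "path E i w k \<Longrightarrow> w = u @ v \<Longrightarrow> \<exists>j. path E i u j \<and> path E j v k"
proof (induction arbitrary: u rule: path.induct)
  case (path_Nil i)
  then show ?case by (auto intro: path.intros)
next
  case (path_One i j w k)
  from path_One.IH[OF path_One.prems] path_One.hyps(1) show ?case by (blast intro: path.path_One)
next
  case (path_Atom i a j w k)
  show ?case
  proof (cases u)
    case Nil
    then show ?thesis using path_Atom by (auto intro: path.intros)
  next
    case (Cons b u')
    then show ?thesis using path_Atom by (auto intro: path.intros)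
  qed
qed

definition basic :: "('i \<times> 'a rexp \<times> 'i) list \<Rightarrow> bool" where
  "basic E \<longleftrightarrow> (\<forall>(i, m, j)\<in>set E. m = One \<or> (\<exists>a. m = Atom a))"

lemma gstar_path:
  assumes "w \<in> lang (gstar E i j)" and "basic E"
  shows "path E i w j"
proof (rule gstar_lang_subset[OF assms(1)])
  show "path E i w j" if "(i, m, j) \<in> set E" "w \<in> lang m" for i m j w
  proof -
    have "m = One \<or> (\<exists>a. m = Atom a)" using assms(2) that(1) by (auto simp: basic_def)
    then show ?thesis
      using that path_One[of i j E "[]" j] path_Atom[of i _ j E "[]" j] path_Nil[of E j] by auto
  qed
qed (auto intro: path_Nil path_append)

definition wexp :: "'a list \<Rightarrow> 'a rexp" where
  "wexp w = foldr (\<lambda>a. (\<odot>) (Atom a)) w One"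

lemma lang_wexp: "lang (wexp w) = {w}"
  by (induction w) (auto simp: wexp_def conc_def)

section \<open>Closures as least solutions of linear systems\<close>

context derivation
begin

lemma gstar_refl: "One \<lesssim> gstar E i i"
  by (induction E) (auto intro: le_plusI)

lemma gstar_left: "(i, m, j) \<in> set E \<Longrightarrow> m \<odot> gstar E j k \<lesssim> gstar E i k"
proof (induction E arbitrary: i j k)
  case Nil
  then show ?case by simp
next
  case (Cons t E)
  obtain o' n p where t: "t = (o', n, p)" by (cases t)
  let ?s = "Star (n \<odot> gstar E p o')" and ?r = "n \<odot> gstar E p k"
  show ?case
  proof (cases "(i, m, j) = t")
    case True
    \<comment> \<open>A step along the new edge is either its last use, which is \<open>?r\<close>,
      or opens a further loop, which unfolding \<open>?s\<close> absorbs.\<close>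
    have "?r \<lesssim> gstar E o' o' \<odot> (?s \<odot> ?r)"
      by (rule le_times1[OF gstar_refl le_times1[OF star_left(1) rle_refl]])
    moreover have "n \<odot> gstar E p o' \<odot> (?s \<odot> ?r) \<lesssim> gstar E o' o' \<odot> (?s \<odot> ?r)"
      by (rule le_times1[OF gstar_refl])
        (use times_mono[OF star_left(2) rle_refl, of "n \<odot> gstar E p o'" ?r] in simp)
    ultimately show ?thesis using True t by (simp add: le_plusI)
  next
    case False
    with Cons have IH: "\<And>k. m \<odot> gstar E j k \<lesssim> gstar E i k" by auto
    have "m \<odot> gstar E j o' \<odot> (?s \<odot> ?r) \<lesssim> gstar E i o' \<odot> (?s \<odot> ?r)"
      by (rule times_mono[OF IH rle_refl])
    then show ?thesis using IH[of k] unfolding t by (simp add: le_plusI)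
  qed
qed

lemma gstar_right: "(i, m, j) \<in> set E \<Longrightarrow> gstar E k i \<odot> m \<lesssim> gstar E k j"
proof (induction E arbitrary: i j k)
  case Nil
  then show ?case by simp
next
  case (Cons t E)
  obtain o' n p where t: "t = (o', n, p)" by (cases t)
  let ?s = "Star (n \<odot> gstar E p o')" and ?r = "n \<odot> gstar E p i"
  show ?case
  proof (cases "(i, m, j) = t")
    case True
    let ?g = "gstar E k o'"
    have 1: "?g \<odot> n \<lesssim> ?g \<odot> (?s \<odot> (n \<odot> gstar E p p))"
      by (intro times_mono rle_refl le_times1 le_times2 gstar_refl star_left)
    \<comment> \<open>The appended use of the new edge becomes the last one, and the former last use
      moves into the star.\<close>
    have "?s \<odot> (n \<odot> gstar E p o') \<odot> n \<lesssim> ?s \<odot> (n \<odot> gstar E p p)"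
      by (rule times_mono[OF star_right le_times2[OF rle_refl gstar_refl]])
    then have "?g \<odot> (?s \<odot> (n \<odot> gstar E p o') \<odot> n) \<lesssim> ?g \<odot> (?s \<odot> (n \<odot> gstar E p p))"
      by (rule times_mono[OF rle_refl])
    with 1 show ?thesis using True t
      by (auto intro!: le_plusI)
  next
    case False
    with Cons have IH: "\<And>k. gstar E k i \<odot> m \<lesssim> gstar E k j" by auto
    have "gstar E k o' \<odot> (?s \<odot> (n \<odot> (gstar E p i \<odot> m))) \<lesssim> gstar E k o' \<odot> (?s \<odot> (n \<odot> gstar E p j))"
      by (intro times_mono IH rle_refl)
    then show ?thesis using IH[of k] unfolding t by (simp add: le_plusI)
  qed
qed

text \<open>The left star rule for matrices: \<open>y\<close> is a prefixed point of the linear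
  system given by \<open>E\<close>, and the closure lies below it. Together with its mirror image
  this carries the later inductions over automata.\<close>

lemma gstar_left_induct:
  "(\<And>i m j. (i, m, j) \<in> set E \<Longrightarrow> m \<odot> y j \<lesssim> y i) \<Longrightarrow> gstar E i j \<odot> y j \<lesssim> y i"
proof (induction E arbitrary: i j)
  case Nil
  then show ?case by simp
next
  case (Cons t E)
  obtain k m l where t: "t = (k, m, l)" by (cases t)
  have IH: "gstar E i j \<odot> y j \<lesssim> y i" for i j using Cons by simp
  have m: "m \<odot> y l \<lesssim> y k" using Cons.prems t by simp
  have ml: "m \<odot> (gstar E l j \<odot> y j) \<lesssim> y k" for j by (rule mult_le2[OF IH m])
  have "Star (m \<odot> gstar E l k) \<odot> (m \<odot> (gstar E l j \<odot> y j)) \<lesssim> y k"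
    by (rule star_left_induct) (use ml in simp_all)
  then have "gstar E i k \<odot> (Star (m \<odot> gstar E l k) \<odot> (m \<odot> (gstar E l j \<odot> y j))) \<lesssim> y i"
    by (rule mult_le2[OF _ IH])
  then show ?case unfolding t using IH by simp
qed

lemma gstar_right_induct:
  "(\<And>i m j. (i, m, j) \<in> set E \<Longrightarrow> y i \<odot> m \<lesssim> y j) \<Longrightarrow> y i \<odot> gstar E i j \<lesssim> y j"
proof (induction E arbitrary: i j)
  case Nil
  then show ?case by simp
next
  case (Cons t E)
  obtain k m l where t: "t = (k, m, l)" by (cases t)
  have IH: "y i \<odot> gstar E i j \<lesssim> y j" for i j using Cons by simp
  have m: "y k \<odot> m \<lesssim> y l" using Cons.prems t by simp
  have ml: "y k \<odot> m \<odot> gstar E l j \<lesssim> y j" for j by (rule mult_le1[OF m IH])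
  have 1: "y k \<odot> Star (m \<odot> gstar E l k) \<lesssim> y k"
    by (rule star_right_induct) (use ml in simp_all)
  have "y i \<odot> gstar E i k \<odot> Star (m \<odot> gstar E l k) \<odot> (m \<odot> gstar E l j) \<lesssim> y j"
    by (rule mult_le1[OF mult_le1[OF IH 1]]) (use ml in simp)
  then show ?case unfolding t using IH by simp
qed

text \<open>Column \<open>k\<close> of the closure is itself a prefixed point, by
  \<open>gstar_left\<close>.\<close>

lemma gstar_trans: "gstar E i j \<odot> gstar E j k \<lesssim> gstar E i k"
  by (rule gstar_left_induct[where y = "\<lambda>i. gstar E i k"]) (rule gstar_left)

lemma gstar_edge: "(i, m, j) \<in> set E \<Longrightarrow> m \<lesssim> gstar E i j"
  by (rule rle_trans[OF le_times2[OF rle_refl gstar_refl] gstar_left])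

lemma path_le_gstar: "path E i w j \<Longrightarrow> wexp w \<lesssim> gstar E i j"
proof (induction rule: path.induct)
  case (path_Nil i)
  then show ?case by (simp add: wexp_def gstar_refl)
next
  case (path_One i j w k)
  then show ?case using rle_trans[OF _ gstar_left[of i One j E k]] by simp
next
  case (path_Atom i a j w k)
  then show ?case using mult_le2[OF _ gstar_left[of i "Atom a" j E k]] by (simp add: wexp_def)
qed

end

text \<open>Antimirov-style automaton whose states are continuations: from \<open>e \<odot> k\<close> it reads a word
  of \<open>e\<close> and ends in \<open>k\<close>.\<close>

primrec thompson :: "'a rexp \<Rightarrow> 'a rexp \<Rightarrow> ('a rexp \<times> 'a rexp \<times> 'a rexp) list" where
  "thompson Zero k = []"
| "thompson One k = [(One \<odot> k, One, k)]"
| "thompson (Atom a) k = [(Atom a \<odot> k, Atom a, k)]"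
| "thompson (e \<oplus> d) k = [((e \<oplus> d) \<odot> k, One, e \<odot> k), ((e \<oplus> d) \<odot> k, One, d \<odot> k)]
     @ thompson e k @ thompson d k"
| "thompson (e \<odot> d) k = ((e \<odot> d) \<odot> k, One, e \<odot> (d \<odot> k)) # thompson e (d \<odot> k) @ thompson d k"
| "thompson (Star e) k = [(Star e \<odot> k, One, k), (Star e \<odot> k, One, e \<odot> (Star e \<odot> k))]
     @ thompson e (Star e \<odot> k)"

lemma thompson_labels: "(s, m, t) \<in> set (thompson e k) \<Longrightarrow> m = One \<or> (\<exists>a\<in>atoms e. m = Atom a)"
  by (induction e arbitrary: k) auto

lemma basic_thompson: "basic (thompson e k)"
  using thompson_labels by (fastforce simp: basic_def)

context derivation
begin

text \<open>States are expressions, so each state can be assigned itself. Every edge respects this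
  assignment, which makes it a prefixed point of the automaton.\<close>

lemma thompson_sound: "(s, m, t) \<in> set (thompson e k) \<Longrightarrow> m \<odot> t \<lesssim> s"
proof (induction e arbitrary: k)
  case (Plus e d)
  have "e \<odot> k \<lesssim> (e \<oplus> d) \<odot> k" "d \<odot> k \<lesssim> (e \<oplus> d) \<odot> k"
    by (intro times_mono rle_refl le_plus1 le_plus2)+
  with Plus show ?case by auto
next
  case (Star e)
  have "k \<lesssim> Star e \<odot> k" by (intro le_times1 star_left rle_refl)
  moreover have "e \<odot> (Star e \<odot> k) \<lesssim> Star e \<odot> k"
    using times_mono[OF star_left(2) rle_refl, of e k] by simp
  ultimately show ?case using Star by auto
qed auto

text \<open>\<open>E\<close> may exceed the automaton of \<open>e\<close>, since the induction
  treats subexpressions inside the automaton of the whole expression.\<close>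

lemma thompson_complete: "set (thompson e k) \<subseteq> set E \<Longrightarrow> e \<lesssim> gstar E (e \<odot> k) k"
proof (induction e arbitrary: k)
  case Zero
  then show ?case by simp
next
  case One
  then show ?case by (intro gstar_edge) simp
next
  case (Atom a)
  then show ?case by (intro gstar_edge) simp
next
  case (Plus e d)
  have "e \<lesssim> gstar E ((e \<oplus> d) \<odot> k) k"
    using rle_trans[OF Plus.IH(1)[of k] rle_trans[OF _ gstar_left[of "(e \<oplus> d) \<odot> k" One "e \<odot> k"]]] Plus.prems by simp
  moreover have "d \<lesssim> gstar E ((e \<oplus> d) \<odot> k) k"
    using rle_trans[OF Plus.IH(2)[of k] rle_trans[OF _ gstar_left[of "(e \<oplus> d) \<odot> k" One "d \<odot> k"]]] Plus.prems by simp
  ultimately show ?case by simp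
next
  case (Times e d)
  have "e \<odot> d \<lesssim> gstar E (e \<odot> (d \<odot> k)) (d \<odot> k) \<odot> gstar E (d \<odot> k) k"
    using Times by (intro times_mono Times.IH) simp_all
  also have "\<dots> \<lesssim> gstar E (e \<odot> (d \<odot> k)) k" by (rule gstar_trans)
  also have "\<dots> \<lesssim> gstar E ((e \<odot> d) \<odot> k) k"
    using gstar_left[of "(e \<odot> d) \<odot> k" One "e \<odot> (d \<odot> k)"] Times.prems by simp
  finally show ?case .
next
  case (Star e)
  let ?k = "Star e \<odot> k"
  have "e \<lesssim> gstar E (e \<odot> ?k) ?k" using Star by simp
  also have "\<dots> \<lesssim> gstar E ?k ?k"
    using gstar_left[of ?k One "e \<odot> ?k"] Star.prems by simp
  \<comment> \<open>Reading \<open>e\<close> leads from \<open>?k\<close> back to \<open>?k\<close>,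
    so the closure at \<open>?k\<close> is stable under multiplication by \<open>e\<close> and the
    star rule applies.\<close>
  finally have "e \<odot> gstar E ?k ?k \<lesssim> gstar E ?k ?k"
    by (rule mult_le1[OF _ gstar_trans])
  from star_left_induct[OF this gstar_refl] have "Star e \<lesssim> gstar E ?k ?k" by simp
  also have "\<dots> \<lesssim> gstar E ?k k"
    using gstar_right[of ?k One k E ?k] Star.prems by simp
  finally show ?case .
qed

lemma thompson_le:
  "gstar (thompson e One) (e \<odot> One) One \<lesssim> e" "e \<lesssim> gstar (thompson e One) (e \<odot> One) One"
  using gstar_left_induct[of "thompson e One" "\<lambda>s. s" "e \<odot> One" One] thompson_sound[of _ _ _ e One]
    thompson_complete[of e One "thompson e One"] by auto

end

section \<open>Recognition by finite monoids and completeness of Kleene algebra\<close>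

interpretation KA: derivation "\<lambda>_ _. False" .

lemma KA_le_lang: "KA.le e d \<Longrightarrow> lang e \<subseteq> lang d"
  unfolding KA.le_def by (drule derivable_lang) auto

text \<open>That a path yields a word of the closure comes from Kleene algebra:
  \<open>wexp w\<close> is provably below the closure, and provable inequalities are inclusions of
  languages.\<close>

lemma gstar_path_iff:
  assumes "basic E"
  shows "w \<in> lang (gstar E i j) \<longleftrightarrow> path E i w j"
  using gstar_path[OF _ assms] KA_le_lang[OF KA.path_le_gstar] by (auto simp: lang_wexp)

text \<open>\<open>Ms\<close> lists the image of \<rho>, a finite monoid with product
  \<open>f\<close>. Its laws on this image are inherited from concatenation through
  \<open>hom\<close>.\<close>

locale recognition =
  fixes \<rho> :: "'a list \<Rightarrow> 'm" and f :: "'m \<Rightarrow> 'm \<Rightarrow> 'm" and Ms :: "'m list" and As :: "'a list"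
  assumes hom: "\<rho> (u @ v) = f (\<rho> u) (\<rho> v)" and Ms: "set Ms = range \<rho>"
begin

definition cayley :: "('m \<times> 'a rexp \<times> 'm) list" where
  "cayley = [(p, Atom a, f p (\<rho> [a])). p \<leftarrow> Ms, a \<leftarrow> As]"

definition class_exp :: "'m \<Rightarrow> 'a rexp" where
  "class_exp m = gstar cayley (\<rho> []) m"

lemma cayley_iff:
  "(p, m, q) \<in> set cayley \<longleftrightarrow> p \<in> set Ms \<and> (\<exists>a\<in>set As. m = Atom a \<and> q = f p (\<rho> [a]))"
  by (auto simp: cayley_def)

lemma basic_cayley: "basic cayley"
  by (auto simp: basic_def cayley_iff)

lemma over_class_exp: "over (set As) (class_exp m)"
  using atoms_gstar[of cayley "\<rho> []" m] by (fastforce simp: class_exp_def cayley_iff)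

lemma f_assoc: "p \<in> set Ms \<Longrightarrow> q \<in> set Ms \<Longrightarrow> r \<in> set Ms \<Longrightarrow> f p (f q r) = f (f p q) r"
  by (auto simp: Ms simp flip: hom)

lemma f_closed: "p \<in> set Ms \<Longrightarrow> q \<in> set Ms \<Longrightarrow> f p q \<in> set Ms"
  by (auto simp: Ms simp flip: hom)

lemma f_unit: "p \<in> set Ms \<Longrightarrow> f (\<rho> []) p = p" "p \<in> set Ms \<Longrightarrow> f p (\<rho> []) = p"
  by (auto simp: Ms simp flip: hom)

lemma rho_in: "\<rho> w \<in> set Ms"
  by (simp add: Ms)

lemma path_cayley_imp: "path cayley p w q \<Longrightarrow> p = \<rho> u \<Longrightarrow> w \<in> lists (set As) \<and> q = \<rho> (u @ w)"
proof (induction arbitrary: u rule: path.induct)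
  case (path_Atom i a j w k)
  have "a \<in> set As" "j = \<rho> (u @ [a])"
    using path_Atom.hyps(1) path_Atom.prems by (simp_all add: cayley_iff hom)
  then show ?case using path_Atom.IH[of "u @ [a]"] by simp
next
  case (path_One i j w k)
  from path_One.hyps(1) show ?case by (simp add: cayley_iff)
qed simp

lemma path_cayley: "w \<in> lists (set As) \<Longrightarrow> path cayley (\<rho> u) w (\<rho> (u @ w))"
proof (induction w arbitrary: u)
  case Nil
  then show ?case by (simp add: path_Nil)
next
  case (Cons a w)
  then have "path cayley (\<rho> (u @ [a])) w (\<rho> (u @ [a] @ w))" using Cons.IH[of "u @ [a]"] by simp
  moreover have "(\<rho> u, Atom a, \<rho> (u @ [a])) \<in> set cayley"
    using Cons.prems by (simp add: cayley_iff rho_in hom)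
  ultimately show ?case using path_Atom[of "\<rho> u" a "\<rho> (u @ [a])" cayley w] by simp
qed

lemma lang_class_exp: "lang (class_exp m) = {w \<in> lists (set As). \<rho> w = m}"
proof -
  have "path cayley (\<rho> []) w m \<longleftrightarrow> w \<in> lists (set As) \<and> \<rho> w = m" for w
    using path_cayley_imp[of "\<rho> []" w m "[]"] path_cayley[of w "[]"] by auto
  then show ?thesis by (simp add: class_exp_def set_eq_iff gstar_path_iff[OF basic_cayley])
qed

definition class_sum :: "'m set \<Rightarrow> 'a rexp" where
  "class_sum K = lsum (map class_exp (filter (\<lambda>m. m \<in> K) Ms))"

text \<open>Left multiplication by \<open>m\<close> maps edges of the right Cayley graph to edges,
  so \<open>\<lambda>p. class_exp (f m p)\<close> is stable under edges on the right. The induction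
  starts at the unit, where the value is \<open>class_exp m\<close>.\<close>

lemma class_exp_mult:
  assumes "m \<in> set Ms" and "n \<in> set Ms"
  shows "KA.le (class_exp m \<odot> class_exp n) (class_exp (f m n))"
proof -
  have "KA.le (gstar cayley (\<rho> []) (f m (\<rho> [])) \<odot> gstar cayley (\<rho> []) n) (gstar cayley (\<rho> []) (f m n))"
    by (rule KA.gstar_right_induct[where y = "\<lambda>p. gstar cayley (\<rho> []) (f m p)"])
      (auto simp: cayley_iff f_assoc[OF assms(1) _ rho_in] f_closed[OF assms(1)] intro!: KA.gstar_right)
  then show ?thesis using assms by (simp add: class_exp_def f_unit)
qed

lemma class_exp_le_sum: "m \<in> K \<Longrightarrow> m \<in> set Ms \<Longrightarrow> KA.le (class_exp m) (class_sum K)"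
  unfolding class_sum_def by (rule KA.le_lsum) simp

lemma class_sum_mult:
  assumes "\<And>m n. m \<in> K \<Longrightarrow> n \<in> L \<Longrightarrow> f m n \<in> N"
  shows "KA.le (class_sum K \<odot> class_sum L) (class_sum N)"
proof -
  have "KA.le (class_exp m \<odot> class_exp n) (class_sum N)"
    if "m \<in> K" "n \<in> L" "m \<in> set Ms" "n \<in> set Ms" for m n
    using that by (intro KA.rle_trans[OF class_exp_mult class_exp_le_sum] assms f_closed)
  then show ?thesis
    by (simp add: class_sum_def[of K] class_sum_def[of L] KA.lsum_times_le_iff KA.times_lsum_le_iff)
qed

text \<open>Products are handled by \<open>class_sum_mult\<close>. For a star, the sum over the
  classes of \<open>lang (Star e)\<close> lies above \<open>One\<close> and is stable under left
  multiplication by \<open>e\<close>, so the left star rule applies.\<close>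

lemma rexp_le_class_sum: "over (set As) e \<Longrightarrow> KA.le e (class_sum (\<rho> ` lang e))"
proof (induction e)
  case Zero
  then show ?case by simp
next
  case One
  have "KA.le One (class_exp (\<rho> []))" by (simp add: class_exp_def KA.gstar_refl)
  also have "KA.le \<dots> (class_sum (\<rho> ` lang One))" by (rule class_exp_le_sum) (simp_all add: rho_in)
  finally show ?case .
next
  case (Atom a)
  have "KA.le (Atom a) (class_exp (\<rho> [a]))"
    unfolding class_exp_def using Atom
    by (intro KA.gstar_edge) (simp add: cayley_iff rho_in flip: hom)
  also have "KA.le \<dots> (class_sum (\<rho> ` lang (Atom a)))" by (rule class_exp_le_sum) (simp_all add: rho_in)
  finally show ?case .
next
  case (Plus e d)
  have "KA.le (class_sum K) (class_sum L)" if "K \<subseteq> L" for K L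
    using that class_exp_le_sum by (auto simp: class_sum_def[of K] KA.lsum_le_iff)
  then have *: "KA.le (class_sum (\<rho> ` lang e)) (class_sum (\<rho> ` lang (e \<oplus> d)))"
    "KA.le (class_sum (\<rho> ` lang d)) (class_sum (\<rho> ` lang (e \<oplus> d)))"
    by (simp_all add: image_mono)
  show ?case
    using KA.rle_trans[OF Plus.IH(1) *(1)] KA.rle_trans[OF Plus.IH(2) *(2)] Plus.prems by simp
next
  case (Times e d)
  then have "KA.le (e \<odot> d) (class_sum (\<rho> ` lang e) \<odot> class_sum (\<rho> ` lang d))"
    by (intro KA.times_mono) simp_all
  also have "KA.le \<dots> (class_sum (\<rho> ` lang (e \<odot> d)))"
    by (rule class_sum_mult) (elim imageE, simp only: hom[symmetric], intro imageI lang_append)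
  finally show ?case .
next
  case (Star e)
  let ?S = "class_sum (\<rho> ` lang (Star e))"
  have "KA.le (e \<odot> ?S) (class_sum (\<rho> ` lang e) \<odot> ?S)"
    using Star by (intro KA.times_mono) simp_all
  also have "KA.le \<dots> ?S"
    by (rule class_sum_mult) (elim imageE, simp only: hom[symmetric], intro imageI star_Cons)
  finally have 1: "KA.le (e \<odot> ?S) ?S" .
  have "KA.le One (class_exp (\<rho> []))" by (simp add: class_exp_def KA.gstar_refl)
  also have "KA.le \<dots> ?S" by (intro class_exp_le_sum rho_in imageI Nil_in_star)
  finally have "KA.le (Star e \<odot> One) ?S" by (rule KA.star_left_induct[OF 1])
  then show ?case by (simp only: KA.one_le)
qed

end

text \<open>The initial state is inserted separately, as the automaton of \<open>Zero\<close> has no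
  edges.\<close>

definition states :: "'a rexp \<Rightarrow> 'a rexp set" where
  "states e = insert (e \<odot> One) (\<Union>(s, m, t)\<in>set (thompson e One). {s, t})"

text \<open>The empty path exists at every expression; the restriction to \<open>states e\<close>
  leaves only finitely many relations.\<close>

definition transitions :: "'a rexp \<Rightarrow> 'a list \<Rightarrow> ('a rexp \<times> 'a rexp) set" where
  "transitions e w = {(s, t). s \<in> states e \<and> path (thompson e One) s w t}"

lemma finite_states: "finite (states e)"
  by (auto simp: states_def)

lemma path_states: "path (thompson e One) s w t \<Longrightarrow> s \<in> states e \<Longrightarrow> t \<in> states e"
  by (induction rule: path.induct) (fastforce simp: states_def)+

lemma transitions_append: "transitions e (u @ v) = transitions e u O transitions e v"
  by (auto simp: transitions_def intro: path_append path_states dest!: path_appendD[OF _ HOL.refl])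

lemma finite_range_transitions: "finite (range (transitions e))"
proof (rule finite_subset)
  show "range (transitions e) \<subseteq> Pow (states e \<times> states e)"
    by (auto simp: transitions_def path_states)
qed (simp add: finite_states)

text \<open>The automaton has initial state \<open>e \<odot> One\<close> and final state
  \<open>One\<close>, and its closure is provably equal to \<open>e\<close>. Membership therefore
  depends only on the transition relation of the word.\<close>

lemma lang_transitions: "w \<in> lang e \<longleftrightarrow> (e \<odot> One, One) \<in> transitions e w"
proof -
  have "lang e = lang (gstar (thompson e One) (e \<odot> One) One)"
    using KA_le_lang[OF KA.thompson_le(1)] KA_le_lang[OF KA.thompson_le(2)] by (rule equalityI[rotated])
  then show ?thesis
    by (simp add: gstar_path_iff[OF basic_thompson] transitions_def states_def)
qed

lemma finite_atoms: "finite (atoms e)"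
  by (induction e) auto

theorem kleene_completeness:
  assumes "lang e \<subseteq> lang d"
  shows "KA.le e d"
proof -
  obtain Ms where Ms: "set Ms = range (transitions d)"
    using finite_list[OF finite_range_transitions[of d]] by metis
  obtain As where As: "set As = atoms e"
    using finite_list[OF finite_atoms[of e]] by metis
  obtain Ss where Ss: "set Ss = states d"
    using finite_list[OF finite_states[of d]] by metis
  interpret recognition "transitions d" "(O)" Ms As
    by unfold_locales (simp_all add: transitions_append Ms)
  let ?E = "thompson d One" and ?i = "d \<odot> One"
  have "KA.le (class_exp m) d" if "m \<in> transitions d ` lang e" for m
  proof -
    \<comment> \<open>\<open>?y p\<close> describes what may still be read up to acceptance after a
      word with relation \<open>p\<close>: one summand for each state reached from the initial
      one.\<close>
    let ?y = "\<lambda>p. lsum (map (\<lambda>s. gstar ?E s One) (filter (\<lambda>s. (?i, s) \<in> p) Ss))"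
    have "KA.le (Atom a \<odot> ?y (p O transitions d [a])) (?y p)" for a p
    proof -
      have "KA.le (Atom a \<odot> gstar ?E t One) (?y p)"
        if "(?i, s) \<in> p" "(s, t) \<in> transitions d [a]" for s t
      proof -
        have s: "s \<in> states d" and "path ?E s [a] t" using that(2) by (auto simp: transitions_def)
        then have "KA.le (Atom a) (gstar ?E s t)"
          using KA.path_le_gstar[of ?E s "[a]" t] by (simp add: wexp_def)
        then have "KA.le (Atom a \<odot> gstar ?E t One) (gstar ?E s One)"
          by (rule KA.mult_le1[OF _ KA.gstar_trans])
        also have "KA.le \<dots> (?y p)" using that(1) s Ss by (intro KA.le_lsum) simp
        finally show ?thesis .
      qed
      then show ?thesis unfolding KA.times_lsum_le_iff by fastforce
    qed
    \<comment> \<open>\<open>?y\<close> is a prefixed point along the Cayley edges, so left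
      induction leads from the class \<open>m\<close> back to the class of the empty word.\<close>
    then have "KA.le (gstar cayley (transitions d []) m \<odot> ?y m) (?y (transitions d []))"
      by (intro KA.gstar_left_induct[where y = ?y]) (auto simp only: cayley_iff)
    also have "KA.le (?y (transitions d [])) (gstar ?E ?i One)"
    proof -
      have "KA.le (gstar ?E s One) (gstar ?E ?i One)" if "(?i, s) \<in> transitions d []" for s
      proof -
        have "KA.le One (gstar ?E ?i s)"
          using that KA.path_le_gstar[of ?E ?i "[]" s] by (simp add: wexp_def transitions_def)
        then show ?thesis
          using KA.mult_le1[OF _ KA.gstar_trans, of One ?E ?i s One] by simp
      qed
      then show ?thesis by (simp add: KA.lsum_le_iff)
    qed
    also have "KA.le (gstar ?E ?i One) d" by (rule KA.thompson_le)
    finally have 1: "KA.le (class_exp m \<odot> ?y m) d" by (simp add: class_exp_def)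
    \<comment> \<open>The inclusion of languages enters here: \<open>m\<close> is the relation of a
      word of \<open>d\<close>, so it reaches the final state and \<open>?y m\<close> lies above
      \<open>One\<close>.\<close>
    from that obtain w where w: "m = transitions d w" "w \<in> lang d" using assms by blast
    then have fin: "(?i, One) \<in> m" by (simp only: lang_transitions)
    then have "One \<in> states d" unfolding w(1) transitions_def using path_states by blast
    then have "KA.le One (?y m)"
      using fin Ss by (intro KA.rle_trans[OF KA.gstar_refl[of ?E One] KA.le_lsum]) simp
    then show ?thesis by (rule KA.rle_trans[OF KA.le_times2[OF KA.rle_refl] 1])
  qed
  then have "KA.le (class_sum (transitions d ` lang e)) d"
    by (auto simp: class_sum_def KA.lsum_le_iff)
  then show ?thesis
    by (rule KA.rle_trans[OF rexp_le_class_sum, rotated]) (simp add: As)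
qed

lemma KA_le_iff:
  assumes "over A e" and "over A d"
  shows "KA_le A e d \<longleftrightarrow> lang e \<subseteq> lang d"
proof
  assume "lang e \<subseteq> lang d"
  then show "KA_le A e d"
    using kleene_completeness[of e d] assms derivable_restrict[where Ax = "\<lambda>_ _. False" and A = A, of "e \<oplus> d" d]
    by (simp add: KA.le_def)
next
  assume "KA_le A e d"
  from derivable_lang[OF this] show "lang e \<subseteq> lang d" by auto
qed

section \<open>Normal forms of programs\<close>

text \<open>Pairs of states joined by a run whose word cancels to the empty word by matching each
  push with its pop. They become the silent edges of the saturated automaton.\<close>

inductive balanced :: "('i \<times> letter rexp \<times> 'i) list \<Rightarrow> 'i \<Rightarrow> 'i \<Rightarrow> bool"
  for E :: "('i \<times> letter rexp \<times> 'i) list" where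
  balanced_refl: "balanced E i i"
| balanced_One: "(i, One, j) \<in> set E \<Longrightarrow> balanced E i j"
| balanced_push_pop: "(i, Atom (Push a), j) \<in> set E \<Longrightarrow> balanced E j k \<Longrightarrow>
    (k, Atom (Pop a), l) \<in> set E \<Longrightarrow> balanced E i l"
| balanced_trans: "balanced E i j \<Longrightarrow> balanced E j k \<Longrightarrow> balanced E i k"

locale stack_automaton = derivation "stack_axiom V"
  for V :: "nat set" +
  fixes E :: "('i \<times> letter rexp \<times> 'i) list" and Qs :: "'i list"
  assumes labels: "(i, m, j) \<in> set E \<Longrightarrow> m = One \<or> (\<exists>a\<in>V. m = Atom (Push a) \<or> m = Atom (Pop a))"
    and states: "(i, m, j) \<in> set E \<Longrightarrow> i \<in> set Qs \<and> j \<in> set Qs"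
begin

notation le  (infix "\<lesssim>" 50)

definition bal_edges :: "('i \<times> letter rexp \<times> 'i) list" where
  "bal_edges = [(i, One, j). i \<leftarrow> Qs, j \<leftarrow> Qs, balanced E i j]"

text \<open>After cancellation a surviving run first pops and then pushes. The cancelled stretches
  are replaced by the silent edges, which \<open>pops\<close> and \<open>pushes\<close>
  share.\<close>

definition pops :: "'i \<Rightarrow> 'i \<Rightarrow> letter rexp" where
  "pops = gstar (filter (\<lambda>(i, m, j). \<exists>a. m = Atom (Pop a)) E @ bal_edges)"

definition pushes :: "'i \<Rightarrow> 'i \<Rightarrow> letter rexp" where
  "pushes = gstar (filter (\<lambda>(i, m, j). \<exists>a. m = Atom (Push a)) E @ bal_edges)"

lemma pure_pop_pops: "pure_pop V (pops i j)"
  unfolding pops_def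
  by (rule order.trans[OF atoms_gstar]) (auto simp: bal_edges_def pop_letters_def dest: labels)

lemma pure_push_pushes: "pure_push V (pushes i j)"
  unfolding pushes_def
  by (rule order.trans[OF atoms_gstar]) (auto simp: bal_edges_def push_letters_def dest: labels)

text \<open>The equation \<open>push a \<cdot> pop a = 1\<close>, read from right to left, inserts a
  matched pair around a balanced run.\<close>

lemma balanced_le: "balanced E i j \<Longrightarrow> One \<lesssim> gstar E i j"
proof (induction rule: balanced.induct)
  case (balanced_refl i)
  show ?case by (rule gstar_refl)
next
  case (balanced_One i j)
  then show ?case by (rule gstar_edge)
next
  case (balanced_push_pop i a j k l)
  have "a \<in> V" using labels[OF balanced_push_pop.hyps(1)] by auto
  then have "One \<lesssim> Atom (Push a) \<odot> Atom (Pop a)"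
    by (intro eq_ge axm push_pop_same)
  also have "\<dots> \<lesssim> Atom (Push a) \<odot> (gstar E j k \<odot> Atom (Pop a))"
    by (intro times_mono rle_refl le_times1 balanced_push_pop.IH)
  also have "\<dots> \<lesssim> Atom (Push a) \<odot> gstar E j l"
    by (intro times_mono rle_refl gstar_right balanced_push_pop.hyps)
  also have "\<dots> \<lesssim> gstar E i l"
    by (intro gstar_left balanced_push_pop.hyps)
  finally show ?case .
next
  case (balanced_trans i j k)
  then show ?case
    using rle_trans[OF le_times2[OF balanced_trans.IH] gstar_trans] by simp
qed

lemma gstar_bal_le:
  assumes "set E' \<subseteq> set E"
  shows "gstar (E' @ bal_edges) i j \<lesssim> gstar E i j"
proof -
  have "gstar (E' @ bal_edges) i j \<odot> gstar E j j \<lesssim> gstar E i j"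
  proof (rule gstar_left_induct[where y = "\<lambda>i. gstar E i j"])
    fix k m l assume "(k, m, l) \<in> set (E' @ bal_edges)"
    then consider "(k, m, l) \<in> set E" | "m = One" "balanced E k l"
      using assms by (auto simp: bal_edges_def)
    then show "m \<odot> gstar E l j \<lesssim> gstar E k j"
    proof cases
      case 1
      then show ?thesis by (rule gstar_left)
    next
      case 2
      then show ?thesis using mult_le1[OF balanced_le gstar_trans] by simp
    qed
  qed
  with le_times2[OF rle_refl gstar_refl] show ?thesis by (rule rle_trans)
qed

text \<open>\<open>k\<close> is the state at which a reduced run stops popping and starts to
  push.\<close>

definition nf :: "'i \<Rightarrow> 'i \<Rightarrow> letter rexp" where
  "nf i j = lsum (map (\<lambda>k. pops i k \<odot> pushes k j) Qs)"

lemma le_nf: "k \<in> set Qs \<Longrightarrow> pops i k \<odot> pushes k j \<lesssim> nf i j"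
  unfolding nf_def by (rule le_lsum) simp

lemma nf_le: "nf i j \<lesssim> gstar E i j"
proof -
  have "pops i k \<odot> pushes k j \<lesssim> gstar E i j" for k
    unfolding pops_def pushes_def
    by (rule rle_trans[OF times_mono[OF gstar_bal_le gstar_bal_le] gstar_trans]) auto
  then show ?thesis by (auto simp: nf_def lsum_le_iff)
qed

lemma bal_edge: "balanced E i j \<Longrightarrow> i \<in> set Qs \<Longrightarrow> j \<in> set Qs \<Longrightarrow> (i, One, j) \<in> set bal_edges"
  by (auto simp: bal_edges_def)

text \<open>A push in front of pops is cancelled by the first pop if the letters agree, gives
  \<open>Zero\<close> if they differ, and survives if only silent edges follow.\<close>

lemma push_pops_le:
  assumes ij: "(i, Atom (Push a), j) \<in> set E" and k: "k \<in> set Qs"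
  shows "Atom (Push a) \<odot> pops j k \<lesssim> nf i k"
proof -
  have i: "i \<in> set Qs" and j: "j \<in> set Qs" and aV: "a \<in> V"
    using states[OF ij] labels[OF ij] by auto
  \<comment> \<open>Invariant while the pops are read from the left: either \<open>a\<close> has
    been cancelled and the rest is a popping run from \<open>i\<close>, or only silent moves have
    been made and \<open>a\<close> is still on top.\<close>
  let ?r = "\<lambda>k. pops i k \<oplus> (if balanced E j k then Atom (Push a) else Zero)"
  let ?P = "filter (\<lambda>(i, m, j). \<exists>a. m = Atom (Pop a)) E @ bal_edges"
  have "?r j \<odot> gstar ?P j k \<lesssim> ?r k"
  proof (rule gstar_right_induct[where y = ?r])
    fix o' m p assume e: "(o', m, p) \<in> set ?P"
    then have 1: "pops i o' \<odot> m \<lesssim> pops i p"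
      unfolding pops_def by (rule gstar_right)
    have 2: "Atom (Push a) \<odot> m \<lesssim> ?r p" if jo: "balanced E j o'"
      using e unfolding set_append Un_iff
    proof
      assume "(o', m, p) \<in> set bal_edges"
      then show ?thesis using jo balanced_trans[of E j o' p] by (auto simp: bal_edges_def le_plus2)
    next
      assume "(o', m, p) \<in> set (filter (\<lambda>(i, m, j). \<exists>a. m = Atom (Pop a)) E)"
      then obtain b where m: "m = Atom (Pop b)" and op: "(o', Atom (Pop b), p) \<in> set E" by auto
      have bV: "b \<in> V" and p: "p \<in> set Qs" using labels[OF op] states[OF op] by auto
      show ?thesis
      proof (cases "a = b")
        case True
        have "Atom (Push a) \<odot> m \<lesssim> One"
          unfolding m True using bV by (intro eq_le axm push_pop_same)
        \<comment> \<open>The push from \<open>i\<close> and the pop into \<open>p\<close> enclose a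
          balanced run, so a silent edge leads from \<open>i\<close> to \<open>p\<close>.\<close>
        also have "One \<lesssim> pops i p"
          unfolding pops_def using balanced_push_pop[OF ij jo] op True i p
          by (intro gstar_edge) (simp add: bal_edge)
        also have "pops i p \<lesssim> ?r p" by (rule le_plus1)
        finally show ?thesis .
      next
        case False
        have "Atom (Push a) \<odot> m \<lesssim> Zero"
          unfolding m using aV bV False by (intro eq_le axm push_pop_diff)
        from this zero_le show ?thesis by (rule rle_trans)
      qed
    qed
    show "?r o' \<odot> m \<lesssim> ?r p"
    proof (cases "balanced E j o'")
      case True
      show ?thesis using rle_trans[OF 1 le_plus1] 2[OF True] True by simp
    next
      case False
      then show ?thesis using rle_trans[OF 1 le_plus1] by simp
    qed
  qed
  moreover have "Atom (Push a) \<lesssim> ?r j" by (simp add: balanced_refl le_plus2)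
  ultimately have "Atom (Push a) \<odot> pops j k \<lesssim> ?r k"
    unfolding pops_def[symmetric] by (rule mult_le1[rotated])
  also have "?r k \<lesssim> nf i k"
  proof -
    \<comment> \<open>The middle state of the normal form is \<open>k\<close> if \<open>a\<close>
      was cancelled and \<open>i\<close> if it survives as a push.\<close>
    have "pops i k \<lesssim> pops i k \<odot> pushes k k"
      unfolding pushes_def by (rule le_times2[OF rle_refl gstar_refl])
    moreover have "Atom (Push a) \<lesssim> pops i i \<odot> pushes i k" if "balanced E j k"
    proof (rule le_times1)
      show "One \<lesssim> pops i i" unfolding pops_def by (rule gstar_refl)
      have "Atom (Push a) \<lesssim> Atom (Push a) \<odot> One" by simp
      also have "\<dots> \<lesssim> pushes i j \<odot> pushes j k"
        unfolding pushes_def using that ij j k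
        by (intro times_mono gstar_edge) (simp_all add: bal_edge)
      also have "\<dots> \<lesssim> pushes i k" unfolding pushes_def by (rule gstar_trans)
      finally show "Atom (Push a) \<lesssim> pushes i k" .
    qed
    ultimately show ?thesis using rle_trans[OF _ le_nf[OF k]] rle_trans[OF _ le_nf[OF i]] by simp
  qed
  finally show ?thesis .
qed

text \<open>The normal forms into \<open>f\<close> are a prefixed point of the automaton: pop edges
  and silent edges extend the popping run, and push edges are moved past it by
  \<open>push_pops_le\<close>.\<close>

lemma nf_left:
  assumes e: "(i, m, j) \<in> set E"
  shows "m \<odot> nf j f \<lesssim> nf i f"
proof -
  have "m \<odot> (pops j k \<odot> pushes k f) \<lesssim> nf i f" if k: "k \<in> set Qs" for k
  proof (cases "\<exists>a. m = Atom (Push a)")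
    case True
    then obtain a where m: "m = Atom (Push a)" by blast
    have "pops i l \<odot> pushes l k \<odot> pushes k f \<lesssim> nf i f" if "l \<in> set Qs" for l
    proof -
      have "pops i l \<odot> (pushes l k \<odot> pushes k f) \<lesssim> pops i l \<odot> pushes l f"
        unfolding pushes_def by (rule times_mono[OF rle_refl gstar_trans])
      also have "\<dots> \<lesssim> nf i f" by (rule le_nf[OF that])
      finally show ?thesis by simp
    qed
    then have "nf i k \<odot> pushes k f \<lesssim> nf i f"
      by (simp add: nf_def[of i k] lsum_times_le_iff)
    then have "Atom (Push a) \<odot> pops j k \<odot> pushes k f \<lesssim> nf i f"
      using push_pops_le[of i a j k] e k m by (blast intro: mult_le1)
    then show ?thesis using m by simp
  next
    case False
    with labels[OF e] consider "m = One" | a where "m = Atom (Pop a)" by auto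
    then have "(i, m, j) \<in> set (filter (\<lambda>(i, m, j). \<exists>a. m = Atom (Pop a)) E @ bal_edges)"
      using e states[OF e] by cases (auto intro: bal_edge balanced_One)
    then have "m \<odot> pops j k \<lesssim> pops i k" unfolding pops_def by (rule gstar_left)
    then have "m \<odot> pops j k \<odot> pushes k f \<lesssim> nf i f"
      by (rule mult_le1[OF _ le_nf[OF k]])
    then show ?thesis by simp
  qed
  then show ?thesis by (simp add: nf_def[of j f] times_lsum_le_iff)
qed

lemma gstar_le_nf:
  assumes "j \<in> set Qs"
  shows "gstar E i j \<lesssim> nf i j"
proof -
  have "gstar E i j \<odot> nf j j \<lesssim> nf i j"
    by (rule gstar_left_induct[where y = "\<lambda>i. nf i j"]) (rule nf_left)
  moreover have "One \<lesssim> nf j j"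
    unfolding pops_def pushes_def
    by (rule rle_trans[OF le_times1[OF _ _] le_nf[OF assms]])
      (simp_all add: pops_def pushes_def gstar_refl)
  ultimately show ?thesis
    using rle_trans[OF le_times2[OF rle_refl, of "nf j j" "gstar E i j"]] by blast
qed

end

lemma normal_form:
  assumes "program V e"
  obtains es where "\<forall>(x, y)\<in>set es. pure_push V x \<and> pure_push V y"
    and "derivable UNIV (stack_axiom V) e (lsum (map (\<lambda>(x, y). bar x \<odot> y) es))"
proof -
  \<comment> \<open>The final state \<open>One\<close> is added since \<open>states e\<close> may
    miss it, and it is needed as a middle state of the normal form.\<close>
  obtain Qs where Qs: "set Qs = insert One (states e)"
    using finite_list[of "insert One (states e)"] finite_states by auto
  let ?E = "thompson e One"
  interpret stack_automaton V ?E Qs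
  proof
    fix i m j assume "(i, m, j) \<in> set ?E"
    then show "m = One \<or> (\<exists>a\<in>V. m = Atom (Push a) \<or> m = Atom (Pop a))"
      using thompson_labels assms by (fastforce simp: push_letters_def pop_letters_def)
    show "i \<in> set Qs \<and> j \<in> set Qs"
      using \<open>(i, m, j) \<in> set ?E\<close> by (fastforce simp: Qs states_def)
  qed
  let ?i = "e \<odot> One"
  have "le e (gstar ?E ?i One)" by (rule thompson_le)
  also have "le \<dots> (nf ?i One)" by (rule gstar_le_nf) (simp add: Qs)
  finally have 1: "le e (nf ?i One)" .
  have "le (nf ?i One) (gstar ?E ?i One)" by (rule nf_le)
  also have "le \<dots> e" by (rule thompson_le)
  finally have eq: "eq e (nf ?i One)" by (rule rle_antisym[OF 1])
  have "\<forall>k. \<exists>x. pure_push V x \<and> pops ?i k = bar x" using bar_surj[OF pure_pop_pops] by blast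
  then obtain x where x: "\<And>k. pure_push V (x k) \<and> pops ?i k = bar (x k)" by metis
  show ?thesis
  proof
    let ?es = "map (\<lambda>k. (x k, pushes k One)) Qs"
    show "\<forall>(x, y)\<in>set ?es. pure_push V x \<and> pure_push V y" using x pure_push_pushes by auto
    have "map (\<lambda>(x, y). bar x \<odot> y) ?es = map (\<lambda>k. pops ?i k \<odot> pushes k One) Qs"
      using x by simp
    with eq show "eq e (lsum (map (\<lambda>(x, y). bar x \<odot> y) ?es))" by (simp only: nf_def)
  qed
qed

section \<open>Pairs of stacks with a common bottom part\<close>

text \<open>Stack contents before and after a run, written bottom first: \<open>z\<close> is a
  common bottom part, \<open>x\<close> the top that is popped and \<open>y\<close> the top that is
  pushed.\<close>

definition spans :: "'a list set \<Rightarrow> 'a list set \<Rightarrow> 'a list set \<Rightarrow> ('a list \<times> 'a list) set" where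
  "spans P Q R = {(z @ x, z @ y) | x y z. x \<in> P \<and> z \<in> Q \<and> y \<in> R}"

lemma bar_word_append: "bar_word (x @ y) = bar_word y @ bar_word x"
  by (simp add: bar_word_def)

lemma bar_letter_bar_letter [simp]: "bar_letter (bar_letter l) = l"
  by (cases l) simp_all

lemma bar_word_bar_word [simp]: "bar_word (bar_word x) = x"
  by (simp add: bar_word_def rev_map comp_def)

text \<open>\<open>bar_word x @ bar_word z @ z @ y\<close> equals
  \<open>bar_word (z @ x) @ (z @ y)\<close>, so the words of a term encode its pairs of
  stacks.\<close>

lemma conc_dagger:
  "lang (bar p) @@ dagger Q @@ R = (\<lambda>(x, y). bar_word x @ y) ` spans (lang p) Q R"
proof (intro equalityI subsetI)
  fix w assume "w \<in> lang (bar p) @@ dagger Q @@ R"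
  then obtain x z y where "w = bar_word x @ (bar_word z @ z) @ y" "x \<in> lang p" "z \<in> Q" "y \<in> R"
    unfolding lang_bar conc_def dagger_def by blast
  then show "w \<in> (\<lambda>(x, y). bar_word x @ y) ` spans (lang p) Q R"
    by (intro image_eqI[of _ _ "(z @ x, z @ y)"]) (auto simp: spans_def bar_word_append)
next
  fix w assume "w \<in> (\<lambda>(x, y). bar_word x @ y) ` spans (lang p) Q R"
  then obtain x z y where "w = bar_word x @ (bar_word z @ z) @ y" "x \<in> lang p" "z \<in> Q" "y \<in> R"
    by (auto simp: spans_def bar_word_append)
  then show "w \<in> lang (bar p) @@ dagger Q @@ R"
    unfolding lang_bar conc_def dagger_def by blast
qed

text \<open>The two components are recovered by filtering the pops and the remaining letters out of
  the word.\<close>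

lemma inj_on_bar_word_append:
  "inj_on (\<lambda>(x, y). bar_word x @ y) (lists (push_letters V) \<times> lists (push_letters V))"
proof (rule inj_on_inverseI)
  let ?pop = "\<lambda>l. \<exists>a. l = Pop a"
  fix w assume "w \<in> lists (push_letters V) \<times> lists (push_letters V)"
  then obtain x y where w: "w = (x, y)" "x \<in> lists (push_letters V)" "y \<in> lists (push_letters V)"
    by blast
  have x: "\<forall>l\<in>set (bar_word x). ?pop l" and y: "\<forall>l\<in>set y. \<not> ?pop l"
    using w by (auto simp: bar_word_def push_letters_def)
  have "filter ?pop (bar_word x @ y) = bar_word x" "filter (\<lambda>l. \<not> ?pop l) (bar_word x @ y) = y"
    using x y by simp_all
  then show "(\<lambda>w. (bar_word (filter ?pop w), filter (\<lambda>l. \<not> ?pop l) w))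
      ((\<lambda>(x, y). bar_word x @ y) w) = w"
    using w(1) by simp
qed

lemma lang_subset_lists: "over A e \<Longrightarrow> lang e \<subseteq> lists A"
proof (induction e)
  case (Star e)
  then have "lang e \<subseteq> lists A" by simp
  then have "set w \<subseteq> A" if "w \<in> lang e" for w
    using that by (auto simp: in_lists_conv_set)
  then show ?case by (fastforce simp: in_lists_conv_set)
next
  case (Times e d)
  then show ?case by (simp, intro conc_subsetI) auto
qed auto

lemma spans_subset:
  assumes "over A p" and "Q \<subseteq> lists A" and "over A r"
  shows "spans (lang p) Q (lang r) \<subseteq> lists A \<times> lists A"
  using lang_subset_lists[OF assms(1)] assms(2) lang_subset_lists[OF assms(3)]
  by (force simp: spans_def)

text \<open>Since encoding pairs as words is injective, the equation of languages in the side
  condition becomes an equation between sets of pairs.\<close>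

lemma side_condition_iff:
  "side_condition V n e1 e2 p q r \<longleftrightarrow>
    (\<forall>i<n. pure_push V (e1 i) \<and> pure_push V (e2 i)) \<and>
    (\<forall>i<n. pure_push V (p i) \<and> pure_push V (q i) \<and> pure_push V (r i)) \<and>
    (\<forall>i<n. dagger_form V (p i) (q i) (r i)) \<and>
    (\<Union>i<n. spans (lang (e1 i)) (lists (push_letters V)) (lang (e2 i))) =
    (\<Union>i<n. spans (lang (p i)) (lang (q i)) (lang (r i)))"
proof -
  let ?f = "\<lambda>(x, y). bar_word x @ y"
  let ?A = "\<Union>i<n. spans (lang (e1 i)) (lists (push_letters V)) (lang (e2 i))"
  let ?B = "\<Union>i<n. spans (lang (p i)) (lang (q i)) (lang (r i))"
  have "?f ` ?A = ?f ` ?B \<longleftrightarrow> ?A = ?B"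
    if "\<forall>i<n. pure_push V (e1 i) \<and> pure_push V (e2 i)"
      "\<forall>i<n. pure_push V (p i) \<and> pure_push V (q i) \<and> pure_push V (r i)"
  proof (rule inj_on_image_eq_iff[OF inj_on_bar_word_append])
    show "?A \<subseteq> lists (push_letters V) \<times> lists (push_letters V)"
      using that by (intro UN_least spans_subset) auto
    show "?B \<subseteq> lists (push_letters V) \<times> lists (push_letters V)"
      using that by (intro UN_least spans_subset lang_subset_lists) auto
  qed
  then show ?thesis
    unfolding side_condition_def conc_dagger image_UN by (intro conj_cong HOL.refl)
qed

section \<open>Longest common prefixes of pairs of words\<close>

definition divergent :: "'a list \<Rightarrow> 'a list \<Rightarrow> bool" where
  "divergent x y \<longleftrightarrow> (\<forall>a u v. x = a # u \<longrightarrow> y \<noteq> a # v)"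

lemma divergent_decomposition: "\<exists>u x' y'. x = u @ x' \<and> y = u @ y' \<and> divergent x' y'"
proof (induction x arbitrary: y)
  case Nil
  then show ?case by (auto simp: divergent_def)
next
  case (Cons a x)
  show ?case
  proof (cases "\<exists>v. y = a # v")
    case True
    then obtain v where v: "y = a # v" by blast
    from Cons.IH[of v] obtain u x' y' where "x = u @ x'" "v = u @ y'" "divergent x' y'" by blast
    then have "a # x = (a # u) @ x' \<and> y = (a # u) @ y' \<and> divergent x' y'" by (simp add: v)
    then show ?thesis by (intro exI)
  next
    case False
    then have "a # x = [] @ (a # x) \<and> y = [] @ y \<and> divergent (a # x) y" by (simp add: divergent_def)
    then show ?thesis by (intro exI)
  qed
qed

text \<open>Divergence of the remainders makes \<open>z\<close> the longest common prefix. If one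
  prefix were longer by a nonempty \<open>u\<close>, the remainders of the other would both begin
  with the first letter of \<open>u\<close>.\<close>

lemma divergent_unique:
  assumes "z @ x = z' @ x'" and "z @ y = z' @ y'" and "divergent x y" and "divergent x' y'"
  shows "z = z' \<and> x = x' \<and> y = y'"
proof -
  have *: "z = z' \<and> x = x' \<and> y = y'"
    if "z = z' @ u" "u @ x = x'" "z @ y = z' @ y'" "divergent x' y'" for z z' x x' y y' u :: "'a list"
    using that by (cases u) (auto simp: divergent_def)
  from assms(1) consider u where "z = z' @ u" "u @ x = x'" | u where "z @ u = z'" "x = u @ x'"
    by (auto simp: append_eq_append_conv2)
  then show ?thesis
  proof cases
    case 1
    then show ?thesis using * assms(2,4) by blast
  next
    case 2
    then show ?thesis using *[of z' z u x' x y' y] assms(2,3) by simp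
  qed
qed

text \<open>Each of the four forms either shows two different first letters or leaves one side
  empty.\<close>

lemma dagger_form_divergent:
  "dagger_form V p q r \<Longrightarrow> x \<in> lang p \<Longrightarrow> y \<in> lang r \<Longrightarrow> divergent x y"
  by (induction rule: dagger_form.induct) (auto simp: divergent_def conc_def)

section \<open>Languages of sums and of hash terms\<close>

lemma lang_lsum: "lang (lsum es) = (\<Union>e\<in>set es. lang e)"
  by (induction es) (auto simp: lsum_def)

lemma atoms_lsum: "atoms (lsum es) = (\<Union>e\<in>set es. atoms e)"
  by (induction es) (auto simp: lsum_def)

lemma rsum_lsum: "rsum f n = lsum (map f [0..<n])"
  by (simp add: rsum_def lsum_def foldr_map comp_def)

lemma lang_rsum: "lang (rsum f n) = (\<Union>i<n. lang (f i))"
  by (auto simp: rsum_lsum lang_lsum)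

lemma atoms_rsum: "atoms (rsum f n) = (\<Union>i<n. atoms (f i))"
  by (auto simp: rsum_lsum atoms_lsum)

lemma lang_hash_term:
  "lang (hash_term p q r) = {x @ Hash # z @ Hash # y | x z y. x \<in> lang p \<and> z \<in> lang q \<and> y \<in> lang r}"
proof -
  have sing: "{[a]} @@ B = (#) a ` B" for a :: letter and B by (auto simp: conc_def)
  have "lang (hash_term p q r) = lang p @@ {[Hash]} @@ lang q @@ {[Hash]} @@ lang r"
    by (simp add: hash_term_def conc_assoc)
  then have "lang (hash_term p q r) = lang p @@ (#) Hash ` (lang q @@ (#) Hash ` lang r)"
    by (simp only: sing)
  then show ?thesis unfolding conc_def by blast
qed

lemma hash_split:
  assumes "x @ Hash # z @ Hash # y = x' @ Hash # z' @ Hash # y'"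
    and "Hash \<notin> set x" "Hash \<notin> set z" "Hash \<notin> set x'" "Hash \<notin> set z'"
  shows "x = x' \<and> z = z' \<and> y = y'"
proof -
  have *: "u = u' \<and> v = v'" if "u @ Hash # v = u' @ Hash # v'" "Hash \<notin> set u" "Hash \<notin> set u'"
    for u u' v v'
    using that
  proof (induction u arbitrary: u')
    case Nil
    then show ?case by (cases u') auto
  next
    case (Cons a u)
    then show ?case by (cases u') auto
  qed
  from *[OF assms(1,2,4)] have "x = x'" and "z @ Hash # y = z' @ Hash # y'" by simp_all
  with *[OF this(2) assms(3,5)] show ?thesis by simp
qed

lemma pure_push_no_Hash:
  assumes "pure_push V e" and "x \<in> lang e"
  shows "Hash \<notin> set x"
proof -
  have "x \<in> lists (push_letters V)" using lang_subset_lists[OF assms(1)] assms(2) by (rule subsetD)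
  then show ?thesis by (auto simp: push_letters_def)
qed

text \<open>A hash word determines the triple \<open>(x, z, y)\<close> by its separators, and a pair
  \<open>(z @ x, z @ y)\<close> determines it because \<open>x\<close> and \<open>y\<close> diverge.
  Both inclusions therefore compare the same triples.\<close>

lemma hash_lang_subset_iff:
  assumes "\<forall>i<m. dagger_form V (p i) (q i) (r i)"
    and "\<forall>i<m. pure_push V (p i) \<and> pure_push V (q i) \<and> pure_push V (r i)"
    and "\<forall>j<n. dagger_form V (u j) (v j) (w j)"
    and "\<forall>j<n. pure_push V (u j) \<and> pure_push V (v j) \<and> pure_push V (w j)"
  shows "lang (rsum (\<lambda>i. hash_term (p i) (q i) (r i)) m) \<subseteq>
      lang (rsum (\<lambda>j. hash_term (u j) (v j) (w j)) n) \<longleftrightarrow>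
    (\<Union>i<m. spans (lang (p i)) (lang (q i)) (lang (r i))) \<subseteq>
    (\<Union>j<n. spans (lang (u j)) (lang (v j)) (lang (w j)))"
    (is "?L \<subseteq> ?L' \<longleftrightarrow> ?S \<subseteq> ?S'")
proof
  assume sub: "?L \<subseteq> ?L'"
  show "?S \<subseteq> ?S'"
  proof
    fix st assume "st \<in> ?S"
    then obtain i x z y where i: "i < m" and st: "st = (z @ x, z @ y)"
      and mem: "x \<in> lang (p i)" "z \<in> lang (q i)" "y \<in> lang (r i)"
      by (auto simp: spans_def)
    then have "x @ Hash # z @ Hash # y \<in> ?L" by (auto simp: lang_rsum lang_hash_term)
    with sub have "x @ Hash # z @ Hash # y \<in> ?L'" by blast
    then obtain j x' z' y' where j: "j < n" and eq: "x @ Hash # z @ Hash # y = x' @ Hash # z' @ Hash # y'"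
      and mem': "x' \<in> lang (u j)" "z' \<in> lang (v j)" "y' \<in> lang (w j)"
      by (auto simp: lang_rsum lang_hash_term)
    have "pure_push V (p i)" "pure_push V (q i)" "pure_push V (u j)" "pure_push V (v j)"
      using assms(2,4) i j by auto
    then have "x = x' \<and> z = z' \<and> y = y'"
      using hash_split[OF eq] mem(1,2) mem'(1,2) by (simp add: pure_push_no_Hash)
    with st j mem' show "st \<in> ?S'" by (auto simp: spans_def)
  qed
next
  assume sub: "?S \<subseteq> ?S'"
  show "?L \<subseteq> ?L'"
  proof
    fix s assume "s \<in> ?L"
    then obtain i x z y where i: "i < m" and s: "s = x @ Hash # z @ Hash # y"
      and mem: "x \<in> lang (p i)" "z \<in> lang (q i)" "y \<in> lang (r i)"
      by (auto simp: lang_rsum lang_hash_term)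
    then have "(z @ x, z @ y) \<in> ?S" by (auto simp: spans_def)
    with sub have "(z @ x, z @ y) \<in> ?S'" by blast
    then obtain j x' z' y' where j: "j < n" and eq: "z @ x = z' @ x'" "z @ y = z' @ y'"
      and mem': "x' \<in> lang (u j)" "z' \<in> lang (v j)" "y' \<in> lang (w j)"
      by (auto simp: spans_def)
    have "dagger_form V (p i) (q i) (r i)" "dagger_form V (u j) (v j) (w j)"
      using assms(1,3) i j by auto
    then have "z = z' \<and> x = x' \<and> y = y'"
      using divergent_unique[OF eq] dagger_form_divergent mem(1,3) mem'(1,3) by auto
    with s j mem' show "s \<in> ?L'" by (auto simp: lang_rsum lang_hash_term)
  qed
qed

section \<open>Soundness\<close>

primrec sem_word :: "nat set \<Rightarrow> 'f set \<Rightarrow> letter list \<Rightarrow> 'f packet rel" where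
  "sem_word V F [] = Id_on (packets V F)"
| "sem_word V F (l # w) = sem_letter V F l O sem_word V F w"

lemma sem_letter_subset: "sem_letter V F l \<subseteq> packets V F \<times> packets V F"
  by (cases l) (auto simp: packets_def)

lemma sem_subset: "sem V F e \<subseteq> packets V F \<times> packets V F"
  by (induction e) (use sem_letter_subset in fastforce)+

lemma sem_word_append: "sem_word V F (u @ v) = sem_word V F u O sem_word V F v"
proof (induction u)
  case Nil
  have "sem_word V F v \<subseteq> packets V F \<times> packets V F"
    by (induction v) (use sem_letter_subset in fastforce)+
  then show ?case by auto
qed auto

lemma sem_lang: "sem V F e = (\<Union>w\<in>lang e. sem_word V F w)"
proof (induction e)
  case (Atom l)
  show ?case using sem_letter_subset[of V F l] by auto
next
  case (Times e d)
  have "(\<Union>w\<in>lang (e \<odot> d). sem_word V F w) = (\<Union>u\<in>lang e. \<Union>v\<in>lang d. sem_word V F (u @ v))"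
    unfolding lang.simps conc_def by blast
  also have "\<dots> = sem V F (e \<odot> d)"
    unfolding sem.simps Times sem_word_append by blast
  finally show ?case ..
next
  case (Star e)
  show ?case
  proof (intro equalityI subsetI)
    fix xy assume "xy \<in> sem V F (Star e)"
    then obtain x y where xy: "xy = (x, y)" "(x, y) \<in> (sem V F e)\<^sup>*" "x \<in> packets V F" by auto
    from xy(2) have "\<exists>w\<in>lang (Star e). (x, y) \<in> sem_word V F w"
    proof (induction rule: rtrancl_induct)
      case base
      show ?case using xy(3) by (intro bexI[OF _ Nil_in_star]) (simp add: Id_on_iff)
    next
      case (step y z)
      from step.IH obtain u where u: "u \<in> lang (Star e)" "(x, y) \<in> sem_word V F u" by blast
      from step.hyps(2) obtain v where v: "v \<in> lang e" "(y, z) \<in> sem_word V F v"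
        unfolding Star by blast
      have "(x, z) \<in> sem_word V F (u @ v)" unfolding sem_word_append using u(2) v(2) by blast
      with star_snoc[OF u(1) v(1)] show ?case by blast
    qed
    then show "xy \<in> (\<Union>w\<in>lang (Star e). sem_word V F w)" using xy(1) by blast
  next
    fix xy assume "xy \<in> (\<Union>w\<in>lang (Star e). sem_word V F w)"
    then obtain ws where "ws \<in> lists (lang e)" "xy \<in> sem_word V F (concat ws)" by auto
    then show "xy \<in> sem V F (Star e)"
    proof (induction ws arbitrary: xy)
      case Nil
      then show ?case by auto
    next
      case (Cons w ws)
      then obtain x y z where xy: "xy = (x, z)" "(x, y) \<in> sem_word V F w" "(y, z) \<in> sem_word V F (concat ws)"
        by (auto simp: sem_word_append)
      have "(x, y) \<in> sem V F e" unfolding Star using xy(2) Cons.hyps(1) by blast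
      moreover have "(y, z) \<in> sem V F (Star e)" using xy(3) by (rule Cons.IH)
      ultimately show ?case
        using sem_subset[of V F e] by (auto simp: xy(1) intro: converse_rtrancl_into_rtrancl)
    qed
  qed
qed simp_all

section \<open>Relations of pops followed by pushes\<close>

lemma sem_word_Push:
  "sem_word V F (map Push ys) = {((h, s), (h, rev ys @ s)) | h s. (h, rev ys @ s) \<in> packets V F}"
proof (induction ys)
  case (Cons y ys)
  show ?case unfolding list.map sem_word.simps Cons by (auto simp: packets_def relcomp_unfold)
qed auto

lemma sem_word_Pop:
  "sem_word V F (map Pop xs) = {((h, xs @ s), (h, s)) | h s. (h, xs @ s) \<in> packets V F}"
proof (induction xs)
  case (Cons x xs)
  show ?case unfolding list.map sem_word.simps Cons by (auto simp: packets_def)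
qed auto

text \<open>Stacks of packets have their top at the head, words in \<open>K\<close> are written
  bottom first; \<open>rev\<close> and \<open>map Push\<close> translate between the two.\<close>

definition stack_rel :: "nat set \<Rightarrow> 'f set \<Rightarrow> (letter list \<times> letter list) set \<Rightarrow> 'f packet rel" where
  "stack_rel V F K = {((h, s), (h, t)) | h s t. (h, s) \<in> packets V F \<and> (h, t) \<in> packets V F \<and>
     (map Push (rev s), map Push (rev t)) \<in> K}"

lemma lists_push_letters: "lists (push_letters V) = map Push ` lists V"
  by (simp add: push_letters_def lists_image)

text \<open>The common bottom part is the portion of the stack left untouched, hence an arbitrary
  word of push letters.\<close>

lemma sem_bar_times:
  assumes "pure_push V x" and "pure_push V y"
  shows "sem V F (bar x \<odot> y) = stack_rel V F (spans (lang x) (lists (push_letters V)) (lang y))"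
proof -
  have [simp]: "bar_word (map Push u) = map Pop (rev u)" for u
    by (simp add: bar_word_def rev_map)
  have words: "\<exists>u'\<in>lists V. u = map Push u'" if "pure_push V e" "u \<in> lang e" for u e
    using lang_subset_lists[OF that(1)] that(2) by (auto simp: lists_push_letters)
  have inj: "map Push u = map Push v \<longleftrightarrow> u = v" for u v
    by (simp add: inj_def)
  show ?thesis
  proof (intro equalityI subsetI)
    fix st assume "st \<in> sem V F (bar x \<odot> y)"
    then obtain u v where uv: "u \<in> lang x" "v \<in> lang y" "st \<in> sem_word V F (bar_word u @ v)"
      unfolding sem_lang by (auto simp: lang_bar conc_def)
    from words[OF assms(1) uv(1)] obtain u' where u': "u = map Push u'" by blast
    from words[OF assms(2) uv(2)] obtain v' where v': "v = map Push v'" by blast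
    from uv(3) obtain h s where st: "st = ((h, rev u' @ s), (h, rev v' @ s))"
      "(h, rev u' @ s) \<in> packets V F" "(h, rev v' @ s) \<in> packets V F"
      unfolding u' v' by (auto simp: sem_word_append sem_word_Push sem_word_Pop)
    have "map Push (rev s) \<in> lists (push_letters V)"
      using st(2) by (auto simp: packets_def lists_push_letters)
    then have "(map Push (rev s) @ u, map Push (rev s) @ v) \<in> spans (lang x) (lists (push_letters V)) (lang y)"
      using uv by (auto simp: spans_def)
    then show "st \<in> stack_rel V F (spans (lang x) (lists (push_letters V)) (lang y))"
      using st by (auto simp: stack_rel_def u' v')
  next
    fix st assume "st \<in> stack_rel V F (spans (lang x) (lists (push_letters V)) (lang y))"
    then obtain h s t z u v where st: "st = ((h, s), (h, t))" "(h, s) \<in> packets V F" "(h, t) \<in> packets V F"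
      and uv: "u \<in> lang x" "v \<in> lang y" and z: "z \<in> lists (push_letters V)"
      and eq: "map Push (rev s) = z @ u" "map Push (rev t) = z @ v"
      unfolding stack_rel_def spans_def by blast
    from words[OF assms(1) uv(1)] obtain u' where u': "u = map Push u'" by blast
    from words[OF assms(2) uv(2)] obtain v' where v': "v = map Push v'" by blast
    from z obtain z' where z': "z = map Push z'" by (auto simp: lists_push_letters)
    have "rev s = z' @ u'" "rev t = z' @ v'"
      using eq unfolding u' v' z' map_append[symmetric] inj by auto
    then have "s = rev u' @ rev z'" "t = rev v' @ rev z'" by (metis rev_append rev_rev_ident)+
    with st have "st \<in> sem_word V F (bar_word u @ v)"
      unfolding u' v' by (auto simp: sem_word_append sem_word_Push sem_word_Pop)
    then show "st \<in> sem V F (bar x \<odot> y)"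
      unfolding sem_lang using uv by (auto simp: lang_bar conc_def)
  qed
qed

lemma stack_rel_UN: "stack_rel V F (\<Union>i\<in>I. K i) = (\<Union>i\<in>I. stack_rel V F (K i))"
  by (auto simp: stack_rel_def)

lemma stack_rel_mono: "K \<subseteq> L \<Longrightarrow> stack_rel V F K \<subseteq> stack_rel V F L"
  by (auto simp: stack_rel_def)

lemma stack_rel_subsetD:
  assumes "stack_rel V F K \<subseteq> stack_rel V F L" and "V \<noteq> {}"
    and "K \<subseteq> lists (push_letters V) \<times> lists (push_letters V)"
  shows "K \<subseteq> L"
proof
  \<comment> \<open>Nonempty \<open>V\<close> provides a header; with any fixed header the stacks in
    \<open>K\<close> can be read off the relation.\<close>
  obtain h where h: "h \<in> F \<rightarrow>\<^sub>E V" using assms(2) by (metis PiE_eq_empty_iff ex_in_conv)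
  fix k assume k: "k \<in> K"
  with assms(3) obtain s t where st: "s \<in> lists V" "t \<in> lists V" "k = (map Push s, map Push t)"
    unfolding lists_push_letters by blast
  have "((h, rev s), (h, rev t)) \<in> stack_rel V F K"
    using h k st by (auto simp: stack_rel_def packets_def)
  with assms(1) have "((h, rev s), (h, rev t)) \<in> stack_rel V F L" by (rule subsetD)
  then show "k \<in> L" using st(3) by (simp add: stack_rel_def)
qed

lemma sem_rsum: "sem V F (rsum f n) = (\<Union>i<n. sem V F (f i))"
  by (auto simp: sem_lang lang_rsum)

text \<open>The side condition trades arbitrary bottom parts for terms with divergent tops, the form
  in which pairs match hash words.\<close>

lemma side_condition_sem:
  assumes "side_condition V n e1 e2 p q r"
  shows "sem V F (rsum (\<lambda>i. bar (e1 i) \<odot> e2 i) n) =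
    stack_rel V F (\<Union>i<n. spans (lang (p i)) (lang (q i)) (lang (r i)))"
proof -
  have "sem V F (rsum (\<lambda>i. bar (e1 i) \<odot> e2 i) n) =
      (\<Union>i<n. stack_rel V F (spans (lang (e1 i)) (lists (push_letters V)) (lang (e2 i))))"
    using assms by (simp add: sem_rsum sem_bar_times side_condition_iff del: sem.simps)
  then show ?thesis using assms by (simp add: side_condition_iff flip: stack_rel_UN)
qed

text \<open>For the rule, the premise gives an inclusion of hash languages, hence of sets of pairs,
  hence of relations.\<close>

lemma stack_axiom_sound: "stack_axiom V e d \<Longrightarrow> sem V F e = sem V F d"
proof (induction rule: stack_axiom.induct)
  case (hash_rule m e1 e2 p q r n d1 d2 u v w)
  have "lang (rsum (\<lambda>i. hash_term (p i) (q i) (r i)) m) \<subseteq> lang (rsum (\<lambda>j. hash_term (u j) (v j) (w j)) n)"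
    using derivable_lang[OF hash_rule(3)] by auto
  then have "(\<Union>i<m. spans (lang (p i)) (lang (q i)) (lang (r i))) \<subseteq>
      (\<Union>j<n. spans (lang (u j)) (lang (v j)) (lang (w j)))"
    using hash_lang_subset_iff[of m V p q r n u v w] hash_rule(1,2) by (simp add: side_condition_iff)
  then have "sem V F (rsum (\<lambda>i. bar (e1 i) \<odot> e2 i) m) \<subseteq> sem V F (rsum (\<lambda>j. bar (d1 j) \<odot> d2 j) n)"
    unfolding side_condition_sem[OF hash_rule(1)] side_condition_sem[OF hash_rule(2)]
    by (rule stack_rel_mono)
  then show ?case by (simp add: Un_absorb1)
qed (auto simp: packets_def)

lemma stack_derivable_sound:
  assumes "derivable A (stack_axiom V) e d"
  shows "sem V F e = sem V F d"
  using assms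
proof (induction rule: derivable.induct)
  case (axm e d)
  then show ?case by (rule stack_axiom_sound)
next
  case (one_left e)
  show ?case using sem_subset[of V F e] by auto
next
  case (one_right e)
  show ?case using sem_subset[of V F e] by auto
next
  case (star_unfold_left e)
  show ?case using sem_subset[of V F e] by (auto intro: converse_rtrancl_into_rtrancl)
next
  case (star_unfold_right e)
  show ?case using sem_subset[of V F e] by (auto intro: rtrancl_into_rtrancl)
next
  case (star_induct_left b a x)
  then have bx: "sem V F b \<subseteq> sem V F x" and ax: "sem V F a O sem V F x \<subseteq> sem V F x"
    by (simp_all only: sem.simps(4,5)) blast+
  have "(s, u) \<in> sem V F x" if "(s, t) \<in> (sem V F a)\<^sup>*" "(t, u) \<in> sem V F b" for s t u
    using that(1) by (induction rule: converse_rtrancl_induct) (use that(2) bx ax in blast)+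
  then show ?case by auto
next
  case (star_induct_right b x a)
  then have bx: "sem V F b \<subseteq> sem V F x" and xa: "sem V F x O sem V F a \<subseteq> sem V F x"
    by (simp_all only: sem.simps(4,5)) blast+
  have "(s, u) \<in> sem V F x" if "(t, u) \<in> (sem V F a)\<^sup>*" "(s, t) \<in> sem V F b" for s t u
    using that(1) by (induction rule: rtrancl_induct) (use that(2) bx xa in blast)+
  then show ?case by auto
next
  case (plus_assoc e f g)
  show ?case by auto
next
  case (plus_comm e f)
  show ?case by auto
qed (simp_all add: O_assoc)

section \<open>Completeness\<close>

lemma spans_empty [simp]: "spans {} Q R = {}"
  by (simp add: spans_def)

lemma (in recognition) lang_class_sum: "lang (class_sum UNIV) = lists (set As)"
  using rho_in by (auto simp: class_sum_def lang_lsum lang_class_exp)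

lemma (in recognition) over_class_sum: "over (set As) (class_sum K)"
  using over_class_exp by (auto simp: class_sum_def atoms_lsum)

text \<open>A remainder keeps its first letter, on which divergence depends, while the rest is
  recorded only by its class. This leaves finitely many branches.\<close>

definition (in recognition) branch :: "'a list \<Rightarrow> 'a rexp" where
  "branch x = (case x of [] \<Rightarrow> One | a # v \<Rightarrow> Atom a \<odot> class_exp (\<rho> v))"

lemma (in recognition) branch_simps [simp]:
  "branch [] = One" "branch (a # v) = Atom a \<odot> class_exp (\<rho> v)"
  by (simp_all add: branch_def)

lemma (in recognition) in_lang_branch:
  assumes "x \<in> lists (set As)"
  shows "x \<in> lang (branch x)"
  using assms by (cases x) (auto simp: conc_def lang_class_exp)

lemma (in recognition) lang_branch_imp:
  assumes "y \<in> lang (branch x)" and "x \<in> lists (set As)"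
  shows "y \<in> lists (set As) \<and> \<rho> y = \<rho> x"
proof (cases x)
  case Nil
  then show ?thesis using assms by simp
next
  case (Cons a v)
  with assms obtain w where w: "y = a # w" "w \<in> lists (set As)" "\<rho> w = \<rho> v"
    by (auto simp: conc_def lang_class_exp)
  have "\<rho> ([a] @ w) = \<rho> ([a] @ v)" unfolding hom w(3) ..
  with w Cons assms(2) show ?thesis by simp
qed

lemma (in recognition) over_branch: "x \<in> lists (set As) \<Longrightarrow> over (set As) (branch x)"
  using over_class_exp by (cases x) auto

lemma (in recognition) finite_branch: "finite (branch ` lists (set As))"
proof (rule finite_subset)
  show "branch ` lists (set As) \<subseteq>
      insert One ((\<lambda>(a, m). Atom a \<odot> class_exp m) ` (set As \<times> set Ms))"
  proof
    fix e assume "e \<in> branch ` lists (set As)"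
    then obtain x where "x \<in> lists (set As)" "e = branch x" by blast
    then show "e \<in> insert One ((\<lambda>(a, m). Atom a \<odot> class_exp m) ` (set As \<times> set Ms))"
      using rho_in by (cases x) auto
  qed
qed simp

text \<open>Branches keep first letters, so divergence of \<open>x\<close> and \<open>y\<close>
  supplies the condition \<open>a \<noteq> b\<close>. The function \<open>c\<close> stands for the
  class expressions, which keeps the statement outside the locale.\<close>

lemma dagger_form_branch:
  assumes "x \<in> lists (push_letters V)" and "y \<in> lists (push_letters V)" and "divergent x y"
    and "pure_push V d" and "\<And>m. pure_push V (c m)"
    and "b = (\<lambda>x. case x of [] \<Rightarrow> One | a # v \<Rightarrow> Atom a \<odot> c v)"
  shows "dagger_form V (b x) d (b y)"
proof (cases x)
  case Nil
  show ?thesis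
  proof (cases y)
    case Nil
    with \<open>x = []\<close> assms(4) show ?thesis by (simp add: assms(6) dagger_form.none)
  next
    case (Cons l v)
    then obtain k where "k \<in> V" "l = Push k" using assms(2) by (auto simp: push_letters_def)
    with \<open>x = []\<close> Cons assms(4,5) show ?thesis by (simp add: assms(6) dagger_form.right)
  qed
next
  case (Cons l u)
  then obtain k where k: "k \<in> V" "l = Push k" using assms(1) by (auto simp: push_letters_def)
  show ?thesis
  proof (cases y)
    case Nil
    with Cons k assms(4,5) show ?thesis by (simp add: assms(6) dagger_form.left)
  next
    case (Cons l' v)
    then obtain k' where "k' \<in> V" "l' = Push k'" using assms(2) by (auto simp: push_letters_def)
    with \<open>x = l # u\<close> Cons k assms(3-5) show ?thesis
      by (simp add: assms(6) dagger_form.both divergent_def)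
  qed
qed

lemma dagger_decomposition:
  assumes "finite V" and "pure_push V e1" and "pure_push V e2"
  obtains ts where
    "\<forall>(p, q, r)\<in>set ts. dagger_form V p q r \<and> pure_push V p \<and> pure_push V q \<and> pure_push V r"
    and "(\<Union>(p, q, r)\<in>set ts. spans (lang p) (lang q) (lang r)) =
      spans (lang e1) (lists (push_letters V)) (lang e2)"
proof -
  \<comment> \<open>Pairing the two transition relations lets one class decide membership in both
    \<open>lang e1\<close> and \<open>lang e2\<close>.\<close>
  let ?\<rho> = "\<lambda>w. (transitions e1 w, transitions e2 w)"
  have "finite (range ?\<rho>)"
    by (rule finite_subset[of _ "range (transitions e1) \<times> range (transitions e2)"])
      (auto simp: finite_range_transitions)
  then obtain Ms where Ms: "set Ms = range ?\<rho>" using finite_list by metis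
  have "finite (push_letters V)" using assms(1) by (simp add: push_letters_def)
  then obtain As where As: "set As = push_letters V" using finite_list by metis
  interpret recognition ?\<rho> "\<lambda>(a, b) (c, d). (a O c, b O d)" Ms As
    by unfold_locales (simp_all add: transitions_append Ms)
  have in_e1: "u \<in> lang e1 \<longleftrightarrow> v \<in> lang e1" and in_e2: "u \<in> lang e2 \<longleftrightarrow> v \<in> lang e2"
    if "?\<rho> u = ?\<rho> v" for u v
    using that by (simp_all add: lang_transitions)
  have cong: "?\<rho> (u @ v) = ?\<rho> (u' @ v')" if "?\<rho> u = ?\<rho> u'" "?\<rho> v = ?\<rho> v'" for u v u' v'
    using that by (simp add: transitions_append)
  let ?B = "branch ` lists (set As)"
  \<comment> \<open>The middle part is an arbitrary bottom followed by a common prefix of the two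
    tops, of which only the class \<open>m\<close> is remembered.\<close>
  let ?q = "\<lambda>m. class_sum UNIV \<odot> class_exp m"
  let ?ok = "\<lambda>(p, q, r). dagger_form V p q r \<and>
    spans (lang p) (lang q) (lang r) \<subseteq> spans (lang e1) (lists (push_letters V)) (lang e2)"
  \<comment> \<open>All admissible candidates contained in the target are collected, so one
    inclusion is immediate and only the covering of the target needs an argument.\<close>
  define T where "T = {t \<in> ?B \<times> ?q ` set Ms \<times> ?B. ?ok t}"
  have "finite (?B \<times> ?q ` set Ms \<times> ?B)"
    by (intro finite_cartesian_product finite_branch finite_imageI finite_set)
  then have "finite T" unfolding T_def by (rule finite_subset[rotated]) blast
  then obtain ts where ts: "set ts = T" using finite_list by blast
  have pure_q: "pure_push V (?q m)" for m
    using over_class_sum over_class_exp by (auto simp: As)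
  have "(\<Union>(p, q, r)\<in>T. spans (lang p) (lang q) (lang r)) =
      spans (lang e1) (lists (push_letters V)) (lang e2)" (is "?L = ?R")
  proof (intro equalityI subsetI)
    fix st assume "st \<in> ?R"
    then obtain x y z where st: "st = (z @ x, z @ y)" and xyz: "x \<in> lang e1" "y \<in> lang e2"
      "z \<in> lists (push_letters V)"
      unfolding spans_def by blast
    obtain u x' y' where u: "x = u @ x'" "y = u @ y'" and div: "divergent x' y'"
      using divergent_decomposition[of x y] by blast
    have xy: "x \<in> lists (set As)" "y \<in> lists (set As)"
      unfolding As using lang_subset_lists[OF assms(2)] lang_subset_lists[OF assms(3)] xyz(1,2) by blast+
    then have words: "u \<in> lists (set As)" "x' \<in> lists (set As)" "y' \<in> lists (set As)"
      unfolding u by auto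
    \<comment> \<open>The triple covering \<open>st\<close>: past the longest common prefix
      \<open>u\<close> of \<open>x\<close> and \<open>y\<close> the remainders become branches, and
      \<open>u\<close> contributes its class.\<close>
    let ?t = "(branch x', ?q (?\<rho> u), branch y')"
    have "dagger_form V (branch x') (?q (?\<rho> u)) (branch y')"
      by (rule dagger_form_branch[where c = "\<lambda>v. class_exp (?\<rho> v)"])
        (use words div pure_q over_class_exp in \<open>simp_all add: As branch_def[abs_def]\<close>)
    moreover have "spans (lang (branch x')) (lang (?q (?\<rho> u))) (lang (branch y')) \<subseteq> ?R"
    proof
      fix st' assume "st' \<in> spans (lang (branch x')) (lang (?q (?\<rho> u))) (lang (branch y'))"
      then obtain v w s where s: "st' = (s @ v, s @ w)" "s \<in> lang (?q (?\<rho> u))"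
        and vw: "v \<in> lang (branch x')" "w \<in> lang (branch y')"
        unfolding spans_def by blast
      from s(2) obtain z' u' where z': "s = z' @ u'" "z' \<in> lists (set As)" and u': "?\<rho> u' = ?\<rho> u"
        unfolding lang.simps(5) lang_class_sum lang_class_exp conc_def by blast
      have st': "st' = (z' @ (u' @ v), z' @ (u' @ w))" by (simp add: s z')
      have "?\<rho> v = ?\<rho> x'" "?\<rho> w = ?\<rho> y'"
        using lang_branch_imp[OF vw(1) words(2)] lang_branch_imp[OF vw(2) words(3)] by blast+
      \<comment> \<open>\<open>u' @ v\<close> and \<open>u' @ w\<close> have the same classes as
        \<open>x\<close> and \<open>y\<close>, so replacing representatives does not leave the two
        languages.\<close>
      then have "u' @ v \<in> lang e1" "u' @ w \<in> lang e2"
        using in_e1[OF cong[OF u']] in_e2[OF cong[OF u']] xyz u by blast+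
      then show "st' \<in> ?R" using z'(2) unfolding st' As spans_def by blast
    qed
    ultimately have "?t \<in> T" unfolding T_def using words rho_in by simp
    moreover have "st \<in> spans (lang (branch x')) (lang (?q (?\<rho> u))) (lang (branch y'))"
    proof -
      have "z @ u \<in> lang (?q (?\<rho> u))"
        using words xyz(3) by (intro lang_append) (simp_all add: lang_class_sum lang_class_exp As)
      then show ?thesis
        using in_lang_branch[OF words(2)] in_lang_branch[OF words(3)]
        unfolding st u append_assoc[symmetric] spans_def by blast
    qed
    ultimately show "st \<in> ?L" by (intro UN_I[of ?t]) simp_all
  qed (auto simp: T_def)
  moreover have "\<forall>(p, q, r)\<in>T. dagger_form V p q r \<and> pure_push V p \<and> pure_push V q \<and> pure_push V r"
  proof -
    have "pure_push V b" if "b \<in> ?B" for b using that over_branch by (auto simp: As)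
    then show ?thesis using pure_q unfolding T_def by blast
  qed
  ultimately show ?thesis using that[of ts] unfolding ts by blast
qed

section \<open>Padding to sums of equal length\<close>

lemma UN_nth: "(\<Union>i<length xs. g (xs ! i)) = (\<Union>x\<in>set xs. g x)"
  unfolding set_conv_nth by blast

lemma UN_pad: "A \<subseteq> B \<Longrightarrow> B \<subseteq> insert a A \<Longrightarrow> g a = {} \<Longrightarrow> (\<Union>x\<in>B. g x) = (\<Union>x\<in>A. g x)"
  by blast

lemma UN_concat_map: "(\<Union>t\<in>set (concat (map T xs)). g t) = (\<Union>x\<in>set xs. \<Union>t\<in>set (T x). g t)"
  by auto

text \<open>Inserting copies of an entry whose term is below \<open>Zero\<close> changes a sum only
  up to provable equality.\<close>

lemma lsum_pad:
  assumes "set es \<subseteq> set es'" and "set es' \<subseteq> insert a (set es)" and "derivation.le Ax (g a) Zero"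
  shows "derivable UNIV Ax (lsum (map g es)) (lsum (map g es'))"
proof -
  interpret derivation Ax .
  show ?thesis
  proof (rule rle_antisym)
    have "le (g x) (lsum (map g es'))" if "x \<in> set es" for x
      using that assms(1) by (intro le_lsum) auto
    then show "le (lsum (map g es)) (lsum (map g es'))" by (simp add: lsum_le_iff)
    have "le (g a) (lsum (map g es))" using assms(3) zero_le by (rule rle_trans)
    moreover have "le (g x) (lsum (map g es))" if "x \<in> set es" for x
      using that by (intro le_lsum) auto
    ultimately have "le (g x) (lsum (map g es))" if "x \<in> set es'" for x
      using that assms(2) by blast
    then show "le (lsum (map g es')) (lsum (map g es))" by (simp add: lsum_le_iff)
  qed
qed

lemma side_condition_exists:
  assumes "finite V" and "program V e"
  obtains n e1 e2 p q r where "side_condition V n e1 e2 p q r"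
    and "derivable UNIV (stack_axiom V) e (rsum (\<lambda>i. bar (e1 i) \<odot> e2 i) n)"
proof -
  interpret S: derivation "stack_axiom V" .
  define trm where "trm xy = bar (fst xy) \<odot> snd xy" for xy
  define span where "span xy = spans (lang (fst xy)) (lists (push_letters V)) (lang (snd xy))" for xy
  define dspan where "dspan t = spans (lang (fst t)) (lang (fst (snd t))) (lang (snd (snd t)))"
    for t :: "letter rexp \<times> letter rexp \<times> letter rexp"
  define ok where "ok t \<longleftrightarrow> dagger_form V (fst t) (fst (snd t)) (snd (snd t)) \<and>
    pure_push V (fst t) \<and> pure_push V (fst (snd t)) \<and> pure_push V (snd (snd t))" for t
  define pure where "pure xy \<longleftrightarrow> pure_push V (fst xy) \<and> pure_push V (snd xy)" for xy
  obtain es where es: "\<forall>(x, y)\<in>set es. pure_push V x \<and> pure_push V y"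
    and "S.eq e (lsum (map (\<lambda>(x, y). bar x \<odot> y) es))"
    by (rule normal_form[OF assms(2)])
  moreover have "trm = (\<lambda>(x, y). bar x \<odot> y)" by (simp add: fun_eq_iff trm_def)
  ultimately have pure: "\<forall>xy\<in>set es. pure xy" and eq: "S.eq e (lsum (map trm es))"
    by (simp_all add: pure_def case_prod_beta)
  have "\<exists>ts. (\<forall>t\<in>set ts. ok t) \<and> (\<Union>t\<in>set ts. dspan t) = span xy" if "xy \<in> set es" for xy
  proof -
    have "pure_push V (fst xy)" "pure_push V (snd xy)" using that pure by (auto simp: pure_def)
    then obtain ts where ts:
      "\<forall>(p, q, r)\<in>set ts. dagger_form V p q r \<and> pure_push V p \<and> pure_push V q \<and> pure_push V r"
      "(\<Union>(p, q, r)\<in>set ts. spans (lang p) (lang q) (lang r)) =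
        spans (lang (fst xy)) (lists (push_letters V)) (lang (snd xy))"
      by (rule dagger_decomposition[OF assms(1)])
    have "\<forall>t\<in>set ts. ok t" using ts(1) by (simp add: ok_def case_prod_beta)
    moreover have "(\<Union>t\<in>set ts. dspan t) = span xy"
      using ts(2) by (simp add: dspan_def span_def case_prod_beta)
    ultimately show ?thesis by blast
  qed
  then obtain T where T_ok: "\<And>xy t. xy \<in> set es \<Longrightarrow> t \<in> set (T xy) \<Longrightarrow> ok t"
    and T_span: "\<And>xy. xy \<in> set es \<Longrightarrow> (\<Union>t\<in>set (T xy). dspan t) = span xy"
    by metis
  define ts where "ts = concat (map T es)"
  \<comment> \<open>The side condition uses one index bound for both families, so each list is
    padded by the length of the other. \<open>(Zero, Zero)\<close> and
    \<open>(One, Zero, One)\<close> have empty spans, and the latter is of the admissible form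
    without outer letters.\<close>
  define es' where "es' = es @ replicate (length ts) (Zero, Zero)"
  define ts' where "ts' = ts @ replicate (length es) (One, Zero, One)"
  define n where "n = length es'"
  have n: "n = length ts'" by (simp add: n_def es'_def ts'_def)
  have es': "set es \<subseteq> set es'" "set es' \<subseteq> insert (Zero, Zero) (set es)"
    and ts': "set ts \<subseteq> set ts'" "set ts' \<subseteq> insert (One, Zero, One) (set ts)"
    by (auto simp: es'_def ts'_def)
  show ?thesis
  proof
    have "pure (Zero, Zero)" by (simp add: pure_def)
    then have "pure xy" if "xy \<in> set es'" for xy
      using that es'(2) pure by blast
    then have pure': "pure (es' ! i)" if "i < n" for i
      using that by (simp add: n_def)
    have "ok (One, Zero, One)" by (simp add: ok_def dagger_form.none)
    moreover have "ok t" if "t \<in> set ts" for t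
    proof -
      from that obtain xy where "xy \<in> set es" "t \<in> set (T xy)" by (auto simp: ts_def)
      then show ?thesis by (rule T_ok)
    qed
    ultimately have "ok t" if "t \<in> set ts'" for t
      using that ts'(2) by blast
    then have ok: "ok (ts' ! i)" if "i < n" for i
      using that by (simp add: n)
    have "(\<Union>i<n. span (es' ! i)) = (\<Union>xy\<in>set es'. span xy)" by (simp only: n_def UN_nth)
    also have "\<dots> = (\<Union>xy\<in>set es. span xy)" by (rule UN_pad[OF es']) (simp add: span_def)
    also have "\<dots> = (\<Union>xy\<in>set es. \<Union>t\<in>set (T xy). dspan t)"
      by (rule SUP_cong[OF HOL.refl T_span[symmetric]])
    also have "\<dots> = (\<Union>t\<in>set ts. dspan t)" by (simp only: ts_def UN_concat_map)
    also have "\<dots> = (\<Union>t\<in>set ts'. dspan t)"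
      by (rule UN_pad[OF ts', symmetric]) (simp add: dspan_def spans_def)
    also have "\<dots> = (\<Union>i<n. dspan (ts' ! i))" by (simp only: n UN_nth)
    finally show "side_condition V n (\<lambda>i. fst (es' ! i)) (\<lambda>i. snd (es' ! i)) (\<lambda>i. fst (ts' ! i))
        (\<lambda>i. fst (snd (ts' ! i))) (\<lambda>i. snd (snd (ts' ! i)))"
      using pure' ok by (simp add: side_condition_iff span_def dspan_def ok_def pure_def)
    have "map (\<lambda>i. bar (fst (es' ! i)) \<odot> snd (es' ! i)) [0..<n] = map trm es'"
      by (rule nth_equalityI) (simp_all add: n_def trm_def)
    then have rsum: "rsum (\<lambda>i. bar (fst (es' ! i)) \<odot> snd (es' ! i)) n = lsum (map trm es')"
      by (simp only: rsum_lsum)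
    have "S.le (trm (Zero, Zero)) Zero" by (simp add: trm_def)
    with es' have "S.eq (lsum (map trm es)) (lsum (map trm es'))" by (rule lsum_pad)
    with eq show "S.eq e (rsum (\<lambda>i. bar (fst (es' ! i)) \<odot> snd (es' ! i)) n)"
      unfolding rsum by (rule S.eq_trans')
  qed
qed

lemma pure_pop_bar: "pure_push V e \<Longrightarrow> pure_pop V (bar e)"
  by (induction e) (auto simp: push_letters_def pop_letters_def)

lemma side_condition_program:
  assumes "side_condition V n e1 e2 p q r"
  shows "program V (rsum (\<lambda>i. bar (e1 i) \<odot> e2 i) n)"
    and "over (push_letters V \<union> {Hash}) (rsum (\<lambda>i. hash_term (p i) (q i) (r i)) n)"
proof -
  have "pure_pop V (bar (e1 i))" "pure_push V (e2 i)" if "i < n" for i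
    using assms that by (simp_all add: side_condition_def pure_pop_bar)
  then show "program V (rsum (\<lambda>i. bar (e1 i) \<odot> e2 i) n)"
    by (simp add: atoms_rsum UN_subset_iff le_supI1 le_supI2)
  have pure: "pure_push V (p i) \<and> pure_push V (q i) \<and> pure_push V (r i)" if "i < n" for i
    using assms that by (simp add: side_condition_def)
  then show "over (push_letters V \<union> {Hash}) (rsum (\<lambda>i. hash_term (p i) (q i) (r i)) n)"
    using pure by (simp add: atoms_rsum hash_term_def UN_subset_iff subset_insertI2)
qed

text \<open>Needed to restrict derivations over all letters to the letters of programs.\<close>

lemma stack_axiom_program: "stack_axiom V e d \<Longrightarrow> program V e \<and> program V d"
proof (induction rule: stack_axiom.induct)
  case (hash_rule m e1 e2 p q r n d1 d2 u v w)
  show ?case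
    using side_condition_program(1)[OF hash_rule(1)] side_condition_program(1)[OF hash_rule(2)] by simp
qed (simp_all add: push_letters_def pop_letters_def)

text \<open>An inclusion of relations passes to sets of pairs and then to hash languages.
  Completeness of Kleene algebra derives the premise from it, and the rule yields the
  inequality.\<close>

lemma hash_rule_le:
  assumes "V \<noteq> {}"
    and e: "side_condition V m e1 e2 p q r" and d: "side_condition V n d1 d2 u v w"
    and sem: "sem V F (rsum (\<lambda>i. bar (e1 i) \<odot> e2 i) m) \<subseteq> sem V F (rsum (\<lambda>j. bar (d1 j) \<odot> d2 j) n)"
  shows "derivation.le (stack_axiom V)
    (rsum (\<lambda>i. bar (e1 i) \<odot> e2 i) m) (rsum (\<lambda>j. bar (d1 j) \<odot> d2 j) n)"
proof -
  have "(\<Union>i<m. spans (lang (p i)) (lang (q i)) (lang (r i))) \<subseteq> lists (push_letters V) \<times> lists (push_letters V)"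
    using e by (intro UN_least spans_subset lang_subset_lists) (simp_all add: side_condition_def)
  then have "(\<Union>i<m. spans (lang (p i)) (lang (q i)) (lang (r i))) \<subseteq>
      (\<Union>j<n. spans (lang (u j)) (lang (v j)) (lang (w j)))"
    by (rule stack_rel_subsetD[OF sem[unfolded side_condition_sem[OF e] side_condition_sem[OF d]] assms(1)])
  then have "lang (rsum (\<lambda>i. hash_term (p i) (q i) (r i)) m) \<subseteq> lang (rsum (\<lambda>j. hash_term (u j) (v j) (w j)) n)"
    using hash_lang_subset_iff[of m V p q r n u v w] e d by (simp add: side_condition_def)
  then have "KA_le (push_letters V \<union> {Hash})
      (rsum (\<lambda>i. hash_term (p i) (q i) (r i)) m) (rsum (\<lambda>j. hash_term (u j) (v j) (w j)) n)"
    by (rule KA_le_iff[OF side_condition_program(2)[OF e] side_condition_program(2)[OF d], THEN iffD2])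
  from stack_axiom.hash_rule[OF e d this] show ?thesis
    by (simp add: derivation.le_def axm)
qed

theorem theorem6p9:
  fixes V :: "nat set" and F :: "'f set" and e d :: "letter rexp"
  assumes "finite V" and "V \<noteq> {}" and "finite F"
    and "program V e" and "program V d"
  shows "stack_derivable V e d \<longleftrightarrow> sem V F e = sem V F d"
proof
  assume "stack_derivable V e d"
  then show "sem V F e = sem V F d"
    unfolding stack_derivable_def by (rule stack_derivable_sound)
next
  assume sem: "sem V F e = sem V F d"
  interpret S: derivation "stack_axiom V" .
  obtain m e1 e2 p q r where e: "side_condition V m e1 e2 p q r"
    and eq_e: "S.eq e (rsum (\<lambda>i. bar (e1 i) \<odot> e2 i) m)"
    by (rule side_condition_exists[OF assms(1,4)])
  obtain n d1 d2 u v w where d: "side_condition V n d1 d2 u v w"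
    and eq_d: "S.eq d (rsum (\<lambda>j. bar (d1 j) \<odot> d2 j) n)"
    by (rule side_condition_exists[OF assms(1,5)])
  \<comment> \<open>Soundness transfers the assumed equality of relations to the two normal
    forms.\<close>
  have "sem V F (rsum (\<lambda>i. bar (e1 i) \<odot> e2 i) m) = sem V F (rsum (\<lambda>j. bar (d1 j) \<odot> d2 j) n)"
    using stack_derivable_sound[OF eq_e, of F] stack_derivable_sound[OF eq_d, of F] sem by simp
  \<comment> \<open>The rule is applied once in each direction, with the roles of the two side
    conditions exchanged.\<close>
  then have "S.eq (rsum (\<lambda>i. bar (e1 i) \<odot> e2 i) m) (rsum (\<lambda>j. bar (d1 j) \<odot> d2 j) n)"
    by (intro S.rle_antisym hash_rule_le[OF assms(2) e d, of F] hash_rule_le[OF assms(2) d e, of F]) simp_all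
  from S.eq_trans'[OF eq_e this] have "S.eq e d" by (rule S.eq_trans'[OF _ eq_sym[OF eq_d]])
  \<comment> \<open>The derivation found is over all letters, including \<open>Hash\<close>; erasing
    foreign letters leaves one over the letters of programs.\<close>
  then show "stack_derivable V e d"
    unfolding stack_derivable_def
    by (rule derivable_restrict[OF _ stack_axiom_program assms(4,5)])
qed

end
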